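(* Let $\Omega\subset\mathbb{R}^d$ be bounded and closed, let $\rho:\Omega\to[0,+\infty)$ be an integrable function, and let $p>0$, $q>0$. For $\varepsilon>0$ and every Borel probability measure $\mu$ on $\Omega$ set $$G_\varepsilon(\mu)=\varepsilon^{\alpha}\int_\Omega\frac{\rho(x)}{(\mu(x))^{p/d}}\,dx+\varepsilon^{-\beta}\int_{\Omega\times\Omega}|x-y|^q\,d(\mu\otimes\mu)(x,y),\qquad \alpha=\frac{p/d}{1+p/d},\quad \beta=\frac{1}{1+p/d},$$ where $\mu(x)$ in the first integral denotes the density of the absolutely continuous part of $\mu$ with respect to Lebesgue measure. Then, as $\varepsilon\to0$, the functionals $G_\varepsilon$ $\Gamma$-converge, with respect to the weak* convergence of probability measures on $\Omega$, to the functional $H$ given by $$H(\delta_{x_0})=\Big(1+\frac{p}{d}\Big)\Big(\frac{2d}{p}\Big)^{\alpha}\int_\Omega(\rho(x))^{\beta}\,|x-x_0|^{\alpha q}\,dx\qquad\text{for every }x_0\in\Omega,$$ and $H(\mu)=+\infty$ for every probability measure $\mu$ on $\Omega$ that is not a Dirac mass.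
   Context: Weak* convergence of probability measures on the compact set $\Omega$ is convergence in duality with the continuous functions on $\Omega$. In the integral $\int_\Omega \rho/\mu^{p/d}\,dx$ only the absolutely continuous part of $\mu$ is considered (the singular part is neglected); the integrand is taken to be $0$ where $\rho=0$, and $+\infty$ where $\rho>0$ and the density of $\mu$ vanishes. $\Gamma$-convergence of $G_\varepsilon$ to $H$ as $\varepsilon\to0$ means, for every probability measure $\mu$ on $\Omega$: (liminf) for every family $\mu_\varepsilon$ converging weakly* to $\mu$ as $\varepsilon\to0$, $\liminf_{\varepsilon\to0}G_\varepsilon(\mu_\varepsilon)\ge H(\mu)$; (limsup) $\inf\{\limsup_{\varepsilon\to0}G_\varepsilon(\mu_\varepsilon): \mu_\varepsilon\rightharpoonup\mu \text{ weakly* as }\varepsilon\to0\}\le H(\mu)$. *)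

theory Defs
  imports "HOL-Probability.Probability"
begin

definition prob_measures_on :: "'a::euclidean_space set \<Rightarrow> 'a measure set" where
  "prob_measures_on \<Omega> = {\<mu>. prob_space \<mu> \<and> sets \<mu> = sets (restrict_space borel \<Omega>)}"

definition dirac_on :: "'a::euclidean_space set \<Rightarrow> 'a \<Rightarrow> 'a measure" where
  "dirac_on \<Omega> x = return (restrict_space borel \<Omega>) x"

definition weak_star_tendsto ::
  "'a::euclidean_space set \<Rightarrow> (real \<Rightarrow> 'a measure) \<Rightarrow> 'a measure \<Rightarrow> bool" where
  "weak_star_tendsto \<Omega> m \<mu> \<longleftrightarrow>
     (\<forall>f::'a \<Rightarrow> real. continuous_on \<Omega> f \<longrightarrow>
        ((\<lambda>\<epsilon>. \<integral>x. f x \<partial>(m \<epsilon>)) \<longlongrightarrow> (\<integral>x. f x \<partial>\<mu>)) (at_right 0))"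

text \<open>
  Families are indexed by all \<^term>\<open>\<epsilon> > 0\<close>; their values at \<^term>\<open>\<epsilon> \<le> 0\<close> are
  unconstrained and irrelevant, since only the filter \<^term>\<open>at_right (0::real)\<close> is used.
\<close>

definition gamma_converges ::
  "'b set \<Rightarrow> ((real \<Rightarrow> 'b) \<Rightarrow> 'b \<Rightarrow> bool) \<Rightarrow> (real \<Rightarrow> 'b \<Rightarrow> ennreal) \<Rightarrow> ('b \<Rightarrow> ennreal) \<Rightarrow> bool" where
  "gamma_converges X conv G H \<longleftrightarrow>
     (\<forall>\<mu>\<in>X.
        (\<forall>m. (\<forall>\<epsilon>>0. m \<epsilon> \<in> X) \<and> conv m \<mu> \<longrightarrow>
             H \<mu> \<le> Liminf (at_right 0) (\<lambda>\<epsilon>. G \<epsilon> (m \<epsilon>))) \<and>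
        Inf {Limsup (at_right 0) (\<lambda>\<epsilon>. G \<epsilon> (m \<epsilon>)) | m. (\<forall>\<epsilon>>0. m \<epsilon> \<in> X) \<and> conv m \<mu>} \<le> H \<mu>)"

text \<open>
  \<^term>\<open>u\<close> is a density of the absolutely continuous part in the Lebesgue decomposition
  \<open>M = density L u + S\<close>, with \<^term>\<open>S\<close> singular with respect to \<^term>\<open>L\<close>. Existence and
  almost everywhere uniqueness of \<^term>\<open>u\<close> are proved below, so the choice made in
  \<open>ac_density\<close> does not affect integrals with respect to \<^term>\<open>L\<close>.
\<close>

definition is_ac_density :: "'a measure \<Rightarrow> 'a measure \<Rightarrow> ('a \<Rightarrow> real) \<Rightarrow> bool" where
  "is_ac_density L M u \<longleftrightarrow>
     u \<in> borel_measurable L \<and> (\<forall>x. 0 \<le> u x) \<and>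
     (\<exists>S. sets S = sets L \<and> (\<exists>N\<in>null_sets L. emeasure S (space L - N) = 0) \<and>
          (\<forall>A\<in>sets L. emeasure M A = emeasure (density L (\<lambda>x. ennreal (u x))) A + emeasure S A))"

definition ac_density :: "'a measure \<Rightarrow> 'a measure \<Rightarrow> 'a \<Rightarrow> real" where
  "ac_density L M = (SOME u. is_ac_density L M u)"

lemma is_ac_density_exists:
  assumes L: "sigma_finite_measure L" and M: "finite_measure M" and sets_eq: "sets M = sets L"
  shows "\<exists>u. is_ac_density L M u"
proof -
  interpret L: sigma_finite_measure L by fact
  interpret M: finite_measure M by fact
  have sp: "space M = space L" using sets_eq by (rule sets_eq_imp_space_eq)
  have ne: "null_sets L \<noteq> {}" by auto
  have "\<exists>f::nat \<Rightarrow> ennreal. incseq f \<and> range f \<subseteq> emeasure M ` null_sets L \<and>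
      Sup (emeasure M ` null_sets L) = (SUP i. f i)"
    by (rule ennreal_Sup_countable_SUP) (use ne in blast)
  then obtain f :: "nat \<Rightarrow> ennreal" where f: "range f \<subseteq> emeasure M ` null_sets L"
      "Sup (emeasure M ` null_sets L) = (SUP i. f i)" by blast
  have "\<forall>i::nat. \<exists>N. N \<in> null_sets L \<and> f i = emeasure M N" using f(1) by blast
  then obtain N where N: "\<And>i. N i \<in> null_sets L" "\<And>i. f i = emeasure M (N i)" by metis
  define Z where "Z = (\<Union>i::nat. N i)"
  have Z: "Z \<in> null_sets L" unfolding Z_def using N(1) by auto
  have ZM: "Z \<in> sets M" using Z sets_eq by auto
  have max: "emeasure M A \<le> emeasure M Z" if "A \<in> null_sets L" for A
  proof -
    have "emeasure M A \<le> (SUP i. f i)" unfolding f(2)[symmetric] using that by (auto intro: SUP_upper)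
    also have "\<dots> \<le> emeasure M Z"
      unfolding N(2) by (intro SUP_least emeasure_mono ZM) (auto simp: Z_def)
    finally show ?thesis .
  qed
  have zero: "emeasure M (A - Z) = 0" if A: "A \<in> null_sets L" for A
  proof -
    have AM: "A \<in> sets M" using A sets_eq by auto
    have "emeasure M Z + emeasure M (A - Z) = emeasure M (Z \<union> (A - Z))"
      using ZM AM by (intro plus_emeasure) auto
    also have "\<dots> \<le> emeasure M Z"
      by (rule max) (use A Z in \<open>simp add: null_sets.Un\<close>)
    finally have "emeasure M Z + emeasure M (A - Z) \<le> emeasure M Z + 0" by simp
    then show ?thesis
      unfolding ennreal_add_left_cancel_le using M.emeasure_finite[of Z] by auto
  qed
  define M' where "M' = density M (indicator (space M - Z))"
  have emM': "emeasure M' A = emeasure M (A - Z)" if "A \<in> sets M" for A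
  proof -
    have [measurable]: "A \<in> sets M" "Z \<in> sets M" using that ZM by auto
    have "emeasure M' A = (\<integral>\<^sup>+x. indicator (A - Z) x \<partial>M)"
      unfolding M'_def
      by (subst emeasure_density, measurable, intro nn_integral_cong)
        (auto split: split_indicator)
    then show ?thesis by simp
  qed
  have setsM': "sets M' = sets L" by (simp add: M'_def sets_eq)
  have "absolutely_continuous L M'"
    unfolding absolutely_continuous_def
  proof
    fix A assume A: "A \<in> null_sets L"
    then show "A \<in> null_sets M'"
      using zero[OF A] emM'[of A] setsM' sets_eq by (auto simp: null_sets_def)
  qed
  from L.Radon_Nikodym[OF this setsM'] obtain g where
    g[measurable]: "g \<in> borel_measurable L" and gM': "density L g = M'" by auto
  have "integral\<^sup>N L g = emeasure M' (space L)"
    unfolding gM'[symmetric] by (auto simp: emeasure_density intro!: nn_integral_cong)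
  also have "\<dots> \<noteq> \<infinity>" unfolding sp[symmetric] by (subst emM') (simp_all add: M.emeasure_eq_measure)
  finally have "AE x in L. g x \<noteq> \<infinity>" by (intro nn_integral_PInf_AE) auto
  then have ae: "AE x in L. ennreal (enn2real (g x)) = g x"
    by eventually_elim (simp add: top.not_eq_extremum)
  have dens: "density L (\<lambda>x. ennreal (enn2real (g x))) = M'"
    unfolding gM'[symmetric] by (rule density_cong) (use ae in auto)
  define S where "S = density M (indicator Z)"
  have emS: "emeasure S A = emeasure M (A \<inter> Z)" if "A \<in> sets M" for A
  proof -
    have [measurable]: "A \<in> sets M" "Z \<in> sets M" using that ZM by auto
    have "emeasure S A = (\<integral>\<^sup>+x. indicator (A \<inter> Z) x \<partial>M)"
      unfolding S_def
      by (subst emeasure_density, measurable, intro nn_integral_cong)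
        (auto split: split_indicator)
    then show ?thesis by simp
  qed
  have "is_ac_density L M (\<lambda>x. enn2real (g x))"
    unfolding is_ac_density_def
  proof (intro conjI exI[of _ S] allI ballI bexI[of _ Z])
    show "sets S = sets L" by (simp add: S_def sets_eq)
    show "emeasure S (space L - Z) = 0"
    proof -
      have "space L - Z \<in> sets M" "(space L - Z) \<inter> Z = {}"
        using ZM by (auto simp flip: sp)
      then show ?thesis using emS[of "space L - Z"] by simp
    qed
    fix A assume "A \<in> sets L"
    then have A: "A \<in> sets M" using sets_eq by simp
    have "emeasure M A = emeasure M ((A - Z) \<union> (A \<inter> Z))" by (rule arg_cong[of _ _ "emeasure M"]) blast
    also have "\<dots> = emeasure M (A - Z) + emeasure M (A \<inter> Z)"
      using A ZM by (intro plus_emeasure[symmetric]) auto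
    finally show "emeasure M A = emeasure (density L (\<lambda>x. ennreal (enn2real (g x)))) A + emeasure S A"
      using emM'[OF A] emS[OF A] dens by simp
  qed (use Z in auto)
  then show ?thesis by blast
qed

lemma is_ac_density_unique:
  assumes L: "sigma_finite_measure L"
    and u: "is_ac_density L M u" and v: "is_ac_density L M v"
  shows "AE x in L. u x = v x"
proof -
  interpret L: sigma_finite_measure L by fact
  from u obtain S N where um[measurable]: "u \<in> borel_measurable L" and u0: "\<And>x. 0 \<le> u x"
    and S: "sets S = sets L" "N \<in> null_sets L" "emeasure S (space L - N) = 0"
    and Su: "\<And>A. A \<in> sets L \<Longrightarrow> emeasure M A = emeasure (density L (\<lambda>x. ennreal (u x))) A + emeasure S A"
    unfolding is_ac_density_def by blast
  from v obtain T K where vm[measurable]: "v \<in> borel_measurable L" and v0: "\<And>x. 0 \<le> v x"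
    and T: "sets T = sets L" "K \<in> null_sets L" "emeasure T (space L - K) = 0"
    and Tv: "\<And>A. A \<in> sets L \<Longrightarrow> emeasure M A = emeasure (density L (\<lambda>x. ennreal (v x))) A + emeasure T A"
    unfolding is_ac_density_def by blast
  have NK[measurable]: "N \<in> sets L" "K \<in> sets L" using S T by auto
  have NKn: "N \<union> K \<in> null_sets L" using S T by auto
  have "density L (\<lambda>x. ennreal (u x)) = density L (\<lambda>x. ennreal (v x))"
  proof (rule measure_eqI)
    fix A assume "A \<in> sets (density L (\<lambda>x. ennreal (u x)))"
    then have A: "A \<in> sets L" by simp
    define B where "B = A - (N \<union> K)"
    have B: "B \<in> sets L" using A NK by (auto simp: B_def)
    have sub: "B \<subseteq> space L - N" "B \<subseteq> space L - K" using sets.sets_into_space[OF A] by (auto simp: B_def)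
    have "emeasure S B \<le> emeasure S (space L - N)" using S NK sub by (intro emeasure_mono) auto
    then have SB: "emeasure S B = 0" using S by simp
    have "emeasure T B \<le> emeasure T (space L - K)" using T NK sub by (intro emeasure_mono) auto
    then have TB: "emeasure T B = 0" using T by simp
    have eqB: "emeasure (density L w) A = emeasure (density L w) B" if [measurable]: "w \<in> borel_measurable L" for w :: "'a \<Rightarrow> ennreal"
    proof -
      have "AE x in L. w x * indicator A x = w x * indicator B x"
        using AE_not_in[OF NKn] by eventually_elim (auto simp: B_def split: split_indicator)
      then show ?thesis using A B by (simp add: emeasure_density nn_integral_cong_AE)
    qed
    show "emeasure (density L (\<lambda>x. ennreal (u x))) A = emeasure (density L (\<lambda>x. ennreal (v x))) A"
      using Su[OF B] Tv[OF B] SB TB by (simp add: eqB)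
  qed simp
  then have "AE x in L. ennreal (u x) = ennreal (v x)"
    by (subst (asm) L.density_unique_iff) auto
  then show ?thesis by eventually_elim (use u0 v0 in simp)
qed

lemma ac_density_prob_measure:
  assumes "closed \<Omega>" and "\<mu> \<in> prob_measures_on \<Omega>"
  shows "is_ac_density (restrict_space lborel \<Omega>) \<mu> (ac_density (restrict_space lborel \<Omega>) \<mu>)"
proof -
  have "sigma_finite_measure (restrict_space lborel \<Omega>)"
    using assms(1) by (intro sigma_finite_measure_restrict_space lborel.sigma_finite_measure_axioms) auto
  moreover have "finite_measure \<mu>"
    using assms(2) by (auto simp: prob_measures_on_def prob_space_def)
  moreover have "sets \<mu> = sets (restrict_space lborel \<Omega>)"
    using assms(2) by (simp add: prob_measures_on_def sets_restrict_space)
  ultimately show ?thesis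
    unfolding ac_density_def by (rule someI_ex[OF is_ac_density_exists])
qed

definition cost_integrand :: "real \<Rightarrow> real \<Rightarrow> real \<Rightarrow> ennreal" where
  "cost_integrand t r u = (if r = 0 then 0 else if u = 0 then \<infinity> else ennreal (r / u powr t))"

definition G_functional ::
  "'a::euclidean_space set \<Rightarrow> ('a \<Rightarrow> real) \<Rightarrow> real \<Rightarrow> real \<Rightarrow> real \<Rightarrow> 'a measure \<Rightarrow> ennreal" where
  "G_functional \<Omega> \<rho> p q \<epsilon> \<mu> =
     (let t = p / real DIM('a); \<alpha> = t / (1 + t); \<beta> = 1 / (1 + t) in
        ennreal (\<epsilon> powr \<alpha>) *
          (\<integral>\<^sup>+x. cost_integrand t (\<rho> x) (ac_density (restrict_space lborel \<Omega>) \<mu> x) \<partial>(lebesgue_on \<Omega>))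
        + ennreal (\<epsilon> powr (- \<beta>)) *
          (\<integral>\<^sup>+z. ennreal (norm (fst z - snd z) powr q) \<partial>(\<mu> \<Otimes>\<^sub>M \<mu>)))"

definition H_dirac ::
  "'a::euclidean_space set \<Rightarrow> ('a \<Rightarrow> real) \<Rightarrow> real \<Rightarrow> real \<Rightarrow> 'a \<Rightarrow> ennreal" where
  "H_dirac \<Omega> \<rho> p q x0 =
     (let d = real DIM('a); \<alpha> = (p / d) / (1 + p / d); \<beta> = 1 / (1 + p / d) in
        ennreal ((1 + p / d) * (2 * d / p) powr \<alpha>) *
          (\<integral>\<^sup>+x. ennreal (\<rho> x powr \<beta> * norm (x - x0) powr (\<alpha> * q)) \<partial>(lebesgue_on \<Omega>)))"

definition H_functional ::
  "'a::euclidean_space set \<Rightarrow> ('a \<Rightarrow> real) \<Rightarrow> real \<Rightarrow> real \<Rightarrow> 'a measure \<Rightarrow> ennreal" where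
  "H_functional \<Omega> \<rho> p q \<mu> =
     (if \<exists>x0\<in>\<Omega>. \<mu> = dirac_on \<Omega> x0
      then H_dirac \<Omega> \<rho> p q (THE x0. x0 \<in> \<Omega> \<and> \<mu> = dirac_on \<Omega> x0)
      else \<infinity>)"

lemma dirac_on_inject:
  assumes "x \<in> \<Omega>" "y \<in> \<Omega>" "dirac_on \<Omega> x = dirac_on \<Omega> y"
  shows "x = y"
proof -
  have s: "{x} \<in> sets (restrict_space borel \<Omega>)"
  proof -
    have "\<Omega> \<inter> {x} \<in> sets (restrict_space borel \<Omega>)"
      unfolding sets_restrict_space by (rule imageI) simp
    moreover have "\<Omega> \<inter> {x} = {x}" using assms(1) by blast
    ultimately show ?thesis by simp
  qed
  have "emeasure (dirac_on \<Omega> x) {x} = emeasure (dirac_on \<Omega> y) {x}" using assms(3) by simp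
  then have "indicator {x} x = (indicator {x} y :: ennreal)"
    using s by (simp add: dirac_on_def)
  then show ?thesis by (simp add: indicator_def split: if_splits)
qed

lemma H_functional_dirac:
  assumes "x0 \<in> \<Omega>"
  shows "H_functional \<Omega> \<rho> p q (dirac_on \<Omega> x0) = H_dirac \<Omega> \<rho> p q x0"
proof -
  have "(THE x. x \<in> \<Omega> \<and> dirac_on \<Omega> x0 = dirac_on \<Omega> x) = x0"
    using assms dirac_on_inject by (intro the_equality) blast+
  then show ?thesis using assms by (auto simp: H_functional_def)
qed

end

theory Submission
  imports Defs "HOL-Real_Asymp.Real_Asymp"
begin

text \<open>
  Write \<open>t = p / d\<close>. If \<open>\<mu>\<close> concentrates at \<open>x0\<close> and has density \<open>u\<close> elsewhere, the interaction
  term is essentially \<open>2 \<integral> |x - x0|^q u\<close>, since only pairs with one point near \<open>x0\<close> count to first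
  order. The functional then becomes \<open>\<integral> \<epsilon>^\<alpha> \<rho> / u^t + 2 \<epsilon>^(-\<beta>) |x - x0|^q u\<close>, which can be minimised
  pointwise by Young's inequality; the exponents make the minimum independent of \<open>\<epsilon>\<close>, and it is
  attained at \<open>u = \<epsilon>^\<beta> v\<close> with \<open>v\<close> independent of \<open>\<epsilon>\<close>. This gives the liminf inequality, and also the
  recovery sequence: density \<open>\<epsilon>^\<beta> v\<close> together with an atom at \<open>x0\<close> carrying the remaining mass.
  If the limit is not a Dirac mass, its support has two points, so the double integral stays
  bounded away from \<open>0\<close> and \<open>\<epsilon>^(-\<beta>)\<close> makes the functional blow up.
\<close>

section \<open>Pointwise minimisation\<close>

text \<open>This is the weighted Young inequality with weights \<open>1 / (1 + t)\<close> and
  \<open>t / (1 + t)\<close>. The powers of \<open>u\<close> on its two sides cancel, which leaves a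
  bound free of \<open>u\<close>.\<close>

lemma Young_power_le:
  fixes t a b u :: real
  assumes "t > 0" "a > 0" "b > 0" "u > 0"
  shows "(1 + t) * (b / t) powr (t / (1 + t)) * a powr (1 / (1 + t)) \<le> a / u powr t + b * u"
proof -
  define \<alpha> \<beta> where "\<alpha> = t / (1 + t)" and "\<beta> = 1 / (1 + t)"
  have ab: "\<alpha> > 0" "\<beta> > 0" "\<beta> + \<alpha> = 1" "t * \<beta> = \<alpha>" "(1 + t) * \<beta> = 1" "(1 + t) * \<alpha> = t"
    using assms by (auto simp: \<alpha>_def \<beta>_def field_simps)
  \<comment> \<open>The factors \<open>1 + t\<close> and \<open>(1 + t) / t\<close> undo the
    weights, so that \<open>\<beta> * X\<close> is \<open>a / u powr t\<close> and
    \<open>\<alpha> * Y\<close> is \<open>b * u\<close>. The identity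
    \<open>t * \<beta> = \<alpha>\<close> makes \<open>u\<close> drop out of the product of
    powers.\<close>
  define X Y where "X = (1 + t) * (a / u powr t)" and "Y = (1 + t) * (b / t) * u"
  have pos: "X > 0" "Y > 0" using assms by (auto simp: X_def Y_def)
  have "X powr \<beta> * Y powr \<alpha> \<le> \<beta> * X + \<alpha> * Y"
    using ab pos by (intro Youngs_inequality_0) auto
  moreover have "X powr \<beta> * Y powr \<alpha> = (1 + t) * (b / t) powr \<alpha> * a powr \<beta>"
  proof -
    have one: "(1 + t) powr \<beta> * (1 + t) powr \<alpha> = 1 + t"
      using assms ab by (simp flip: powr_add)
    have "X powr \<beta> = (1 + t) powr \<beta> * (a powr \<beta> / u powr \<alpha>)"
      using assms ab by (simp add: X_def powr_mult powr_divide powr_powr)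
    moreover have "Y powr \<alpha> = (1 + t) powr \<alpha> * (b / t) powr \<alpha> * u powr \<alpha>"
      using assms by (simp add: Y_def powr_mult powr_divide)
    ultimately have "X powr \<beta> * Y powr \<alpha>
        = ((1 + t) powr \<beta> * (1 + t) powr \<alpha>) * ((a powr \<beta> / u powr \<alpha>) * ((b / t) powr \<alpha> * u powr \<alpha>))"
      by (simp only: ac_simps)
    also have "\<dots> = (1 + t) * (a powr \<beta> * (b / t) powr \<alpha>)"
      unfolding one using \<open>u > 0\<close> by simp
    finally show ?thesis by (simp only: ac_simps)
  qed
  moreover have "\<beta> * X + \<alpha> * Y = a / u powr t + b * u"
  proof -
    have "\<beta> * X = ((1 + t) * \<beta>) * (a / u powr t)" by (simp only: X_def ac_simps)
    moreover have "\<alpha> * Y = ((1 + t) * \<alpha>) * (b / t * u)" by (simp only: Y_def ac_simps)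
    ultimately have "\<beta> * X + \<alpha> * Y = a / u powr t + t * (b / t * u)" unfolding ab(5,6) by simp
    then show ?thesis using \<open>t > 0\<close> by simp
  qed
  ultimately show ?thesis by (simp add: \<alpha>_def \<beta>_def)
qed

text \<open>The given \<open>u\<close> is the critical point, where
  \<open>u powr (1 + t) = t * a / b\<close>. There the first term equals \<open>b * u / t\<close>,
  so the sum is \<open>(1 + t) * (b / t) * u\<close>, and only exponents remain to be
  collected.\<close>

lemma Young_power_eq:
  fixes t a b u :: real
  assumes "t > 0" "a > 0" "b > 0" and u: "u = (t * a / b) powr (1 / (1 + t))"
  shows "a / u powr t + b * u = (1 + t) * (b / t) powr (t / (1 + t)) * a powr (1 / (1 + t))"
proof -
  have upos: "u > 0" using assms by simp
  have "u * u powr t = u powr (1 + t)" using upos by (simp add: powr_add)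
  also have "\<dots> = t * a / b" using assms by (simp add: powr_powr)
  finally have "a / u powr t = b * u / t" using assms upos by (simp add: field_simps)
  then have "a / u powr t + b * u = (1 + t) * (b / t) * u"
    using assms by (simp add: field_simps)
  also have "\<dots> = (1 + t) * (b / t) * ((b / t) powr (- 1 / (1 + t)) * a powr (1 / (1 + t)))"
    using assms by (simp add: powr_divide powr_mult powr_minus_divide)
  also have "\<dots> = (1 + t) * (b / t) powr (1 + (- 1 / (1 + t))) * a powr (1 / (1 + t))"
    using assms by (subst powr_add) simp
  also have "1 + (- 1 / (1 + t)) = t / (1 + t)" using assms by (simp add: field_simps)
  finally show ?thesis .
qed

text \<open>Extends Young's bound to the degenerate values: for \<open>r = 0\<close> or
  \<open>b = 0\<close> the left side vanishes, and for \<open>u = 0 < r\<close> the right side is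
  infinite. The factor \<open>a\<close> is kept separate because it will be the prefactor
  \<open>\<epsilon> powr \<alpha>\<close>.\<close>

lemma cost_integrand_lower_bound:
  fixes t :: real
  assumes "t > 0" "a > 0" "r \<ge> 0" "b \<ge> 0" "u \<ge> 0"
  shows "ennreal ((1 + t) * (b / t) powr (t / (1 + t)) * (a * r) powr (1 / (1 + t)))
           \<le> ennreal a * cost_integrand t r u + ennreal (b * u)"
proof (cases "r = 0 \<or> u = 0 \<or> b = 0")
  case True
  then show ?thesis using assms by (auto simp: cost_integrand_def ennreal_mult_top)
next
  case False
  then have "(1 + t) * (b / t) powr (t / (1 + t)) * (a * r) powr (1 / (1 + t)) \<le> a * (r / u powr t) + b * u"
    using Young_power_le[of t "a * r" b u] assms by simp
  then show ?thesis
    using False assms by (simp add: cost_integrand_def flip: ennreal_mult ennreal_plus)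
qed

text \<open>Where \<open>r = 0\<close> the minimiser \<open>v\<close> is itself 0, and the value 0
  of the integrand at \<open>r = 0\<close> keeps the equality valid.\<close>

lemma cost_integrand_minimum:
  fixes t b r :: real
  assumes "t > 0" "b > 0" "r \<ge> 0" and v: "v = (t * r / b) powr (1 / (1 + t))"
  shows "cost_integrand t r v + ennreal (b * v)
       = ennreal ((1 + t) * (b / t) powr (t / (1 + t)) * r powr (1 / (1 + t)))"
proof (cases "r = 0")
  case True
  then show ?thesis by (simp add: cost_integrand_def v)
next
  case False
  then have "v > 0" using assms by simp
  then show ?thesis
    using False assms Young_power_eq[of t r b v]
    by (simp add: cost_integrand_def flip: ennreal_plus)
qed

text \<open>The cost is homogeneous of degree \<open>- t\<close> in the density. With
  \<open>c = \<epsilon> powr \<beta>\<close> one has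
  \<open>c powr t = \<epsilon> powr \<alpha>\<close>, so the prefactor of the first integral is
  absorbed by the density.\<close>

lemma cost_integrand_scale:
  assumes "t > 0" "c > 0" "r \<ge> 0" "v \<ge> 0"
  shows "ennreal (c powr t) * cost_integrand t r (c * v) = cost_integrand t r v"
  using assms
  by (auto simp: cost_integrand_def ennreal_mult_top powr_mult simp flip: ennreal_mult)

lemma measurable_cost_integrand [measurable]:
  assumes [measurable]: "f \<in> borel_measurable M" "g \<in> borel_measurable M"
  shows "(\<lambda>x. cost_integrand t (f x) (g x)) \<in> borel_measurable M"
  unfolding cost_integrand_def by measurable

section \<open>Sum of two measures\<close>

text \<open>Serves to write a measure as its absolutely continuous part plus a singular part. The
  sigma-algebra is that of \<open>M\<close>; the lemmas on values and integrals below assume that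
  \<open>N\<close> has the same one, which makes the set function countably additive.\<close>

definition add_measure :: "'a measure \<Rightarrow> 'a measure \<Rightarrow> 'a measure" where
  "add_measure M N = measure_of (space M) (sets M) (\<lambda>A. emeasure M A + emeasure N A)"

lemma sets_add_measure [simp, measurable_cong]: "sets (add_measure M N) = sets M"
  by (simp add: add_measure_def)

lemma space_add_measure [simp]: "space (add_measure M N) = space M"
  by (simp add: add_measure_def)

lemma emeasure_add_measure:
  assumes "sets N = sets M" "A \<in> sets M"
  shows "emeasure (add_measure M N) A = emeasure M A + emeasure N A"
  unfolding add_measure_def
proof (rule emeasure_measure_of_sigma)
  show "sigma_algebra (space M) (sets M)" by (rule sets.sigma_algebra_axioms)
  show "positive (sets M) (\<lambda>A. emeasure M A + emeasure N A)" by (simp add: positive_def)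
  show "countably_additive (sets M) (\<lambda>A. emeasure M A + emeasure N A)"
    using assms(1) by (auto intro!: countably_additiveI simp: suminf_emeasure simp flip: suminf_add)
qed fact

lemma nn_integral_add_measure:
  assumes N: "sets N = sets M" and f: "f \<in> borel_measurable M"
  shows "(\<integral>\<^sup>+x. f x \<partial>add_measure M N) = (\<integral>\<^sup>+x. f x \<partial>M) + (\<integral>\<^sup>+x. f x \<partial>N)"
  using f
proof (induct rule: borel_measurable_induct)
  case (cong f g)
  moreover have "space N = space M" using N by (rule sets_eq_imp_space_eq)
  ultimately show ?case by (simp cong: nn_integral_cong_simp)
next
  case (set A)
  then show ?case using N by (simp add: emeasure_add_measure)
next
  case (mult u c)
  then show ?case using N
    by (simp add: nn_integral_cmult distrib_left measurable_cong_sets[OF N] measurable_cong_sets[OF sets_add_measure])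
next
  case (add u v)
  then show ?case using N
    by (simp add: nn_integral_add ac_simps measurable_cong_sets[OF N] measurable_cong_sets[OF sets_add_measure])
next
  case (seq U)
  have [measurable]: "\<And>i. U i \<in> borel_measurable N" "\<And>i. U i \<in> borel_measurable (add_measure M N)"
    using seq N by (simp_all add: measurable_cong_sets[OF N] measurable_cong_sets[OF sets_add_measure])
  \<comment> \<open>Both sequences of integrals increase, which allows the supremum of their sums to
    be split into the sum of their suprema.\<close>
  have "mono (\<lambda>i. \<integral>\<^sup>+x. U i x \<partial>M)" "mono (\<lambda>i. \<integral>\<^sup>+x. U i x \<partial>N)"
    using seq(4) by (auto intro!: monoI nn_integral_mono simp: incseq_def le_fun_def)
  moreover have "(\<integral>\<^sup>+x. (SUP i. U i) x \<partial>K) = (SUP i. \<integral>\<^sup>+x. U i x \<partial>K)"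
    if "\<And>i. U i \<in> borel_measurable K" for K
    using nn_integral_monotone_convergence_SUP[OF seq(4) that] by (simp add: image_comp)
  ultimately show ?case using seq
    by (simp add: ennreal_SUP_add incseq_def mono_def)
qed

section \<open>Liminf inequality\<close>

text \<open>The functionals integrate against Lebesgue measure, whereas the Lebesgue decomposition
  is taken on Borel sets. Completing a measure does not change nonnegative integrals, so all
  estimates can be made on the Borel side.\<close>

lemma nn_integral_lebesgue_on_lborel:
  fixes \<Omega> :: "'a::euclidean_space set"
  assumes "closed \<Omega>"
  shows "(\<integral>\<^sup>+x. f x \<partial>lebesgue_on \<Omega>) = (\<integral>\<^sup>+x. f x \<partial>restrict_space lborel \<Omega>)"
  using assms by (simp add: nn_integral_restrict_space nn_integral_completion)

lemma prob_measures_onD: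
  assumes "\<mu> \<in> prob_measures_on \<Omega>"
  shows "prob_space \<mu>" "sets \<mu> = sets (restrict_space borel \<Omega>)"
    "sets \<mu> = sets (restrict_space lborel \<Omega>)" "space \<mu> = \<Omega>"
proof -
  show "prob_space \<mu>" "sets \<mu> = sets (restrict_space borel \<Omega>)"
    using assms by (auto simp: prob_measures_on_def)
  then show "sets \<mu> = sets (restrict_space lborel \<Omega>)"
    by (simp add: sets_restrict_space)
  then show "space \<mu> = \<Omega>"
    using sets_eq_imp_space_eq[of \<mu> "restrict_space lborel \<Omega>"] by (simp add: space_restrict_space)
qed

lemma borel_measurable_prob_measures_on:
  assumes "\<mu> \<in> prob_measures_on \<Omega>" "f \<in> borel_measurable borel"
  shows "f \<in> borel_measurable \<mu>"
  using measurable_restrict_space1[OF assms(2), of \<Omega>] measurable_cong_sets[OF prob_measures_onD(2)[OF assms(1)] refl]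
  by blast

lemma integrable_continuous_on_compact:
  fixes f :: "'a::euclidean_space \<Rightarrow> real"
  assumes "compact \<Omega>" "\<mu> \<in> prob_measures_on \<Omega>" "continuous_on \<Omega> f"
  shows "integrable \<mu> f"
proof -
  interpret prob_space \<mu> by (rule prob_measures_onD(1)[OF assms(2)])
  have "bounded (f ` \<Omega>)"
    using assms compact_continuous_image compact_imp_bounded by blast
  then obtain B where B: "\<And>x. x \<in> \<Omega> \<Longrightarrow> norm (f x) \<le> B"
    by (auto simp: bounded_iff)
  show ?thesis
  proof (rule integrable_const_bound)
    show "AE x in \<mu>. norm (f x) \<le> B" by (rule AE_I2) (use B in \<open>simp add: prob_measures_onD(4)[OF assms(2)]\<close>)
    show "f \<in> borel_measurable \<mu>"
      using borel_measurable_continuous_on_restrict[OF assms(3)]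
        measurable_cong_sets[OF prob_measures_onD(2)[OF assms(2)] refl] by blast
  qed
qed

text \<open>The measure is the sum of its density part and a singular part, and the latter
  contributes a nonnegative integral.\<close>

lemma nn_integral_ac_density_le:
  assumes u: "is_ac_density L M u" and sets: "sets M = sets L" and f[measurable]: "f \<in> borel_measurable L"
  shows "(\<integral>\<^sup>+x. ennreal (u x) * f x \<partial>L) \<le> (\<integral>\<^sup>+x. f x \<partial>M)"
proof -
  from u obtain S where [measurable]: "u \<in> borel_measurable L" and S: "sets S = sets L"
    and MS: "\<And>A. A \<in> sets L \<Longrightarrow> emeasure M A = emeasure (density L (\<lambda>x. ennreal (u x))) A + emeasure S A"
    unfolding is_ac_density_def by blast
  have "M = add_measure (density L (\<lambda>x. ennreal (u x))) S"
    using S MS sets by (intro measure_eqI) (auto simp: emeasure_add_measure)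
  then have "(\<integral>\<^sup>+x. f x \<partial>M) = (\<integral>\<^sup>+x. f x \<partial>density L (\<lambda>x. ennreal (u x))) + (\<integral>\<^sup>+x. f x \<partial>S)"
    using S by (simp add: nn_integral_add_measure)
  then show ?thesis by (simp add: nn_integral_density)
qed

section \<open>Interaction energy and the lower bound for fixed \<open>\<epsilon>\<close>\<close>

lemma borel_measurable_interaction:
  assumes "\<mu> \<in> prob_measures_on \<Omega>"
  shows "(\<lambda>z. ennreal (norm (fst z - snd z) powr q)) \<in> borel_measurable (\<mu> \<Otimes>\<^sub>M \<mu>)"
proof -
  have [measurable]: "(\<lambda>x. x) \<in> measurable \<mu> borel"
    by (rule borel_measurable_prob_measures_on[OF assms]) simp
  show ?thesis by measurable
qed

lemma nn_integral_interaction: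
  assumes "\<mu> \<in> prob_measures_on \<Omega>"
  shows "(\<integral>\<^sup>+z. ennreal (norm (fst z - snd z) powr q) \<partial>(\<mu> \<Otimes>\<^sub>M \<mu>))
       = (\<integral>\<^sup>+x. (\<integral>\<^sup>+y. ennreal (norm (x - y) powr q) \<partial>\<mu>) \<partial>\<mu>)"
proof -
  interpret prob_space \<mu> by (rule prob_measures_onD(1)[OF assms])
  show ?thesis using nn_integral_fst[OF borel_measurable_interaction[OF assms, of q]] by simp
qed

text \<open>If one of the two points lies within \<open>\<delta>\<close> of \<open>x0\<close>, the
  triangle inequality bounds their distance below by that of the other point to \<open>x0\<close>,
  less \<open>\<delta>\<close>. The factor 2 arises because either point may be the near one; it
  becomes the 2 in the constant of the limit functional.\<close>

lemma interaction_ge_tail: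
  fixes x0 :: "'a::euclidean_space"
  assumes \<mu>: "\<mu> \<in> prob_measures_on \<Omega>" and "q > 0"
  shows "2 * emeasure \<mu> (\<Omega> \<inter> ball x0 \<delta>) * (\<integral>\<^sup>+x. ennreal (max 0 (norm (x - x0) - \<delta>) powr q) \<partial>\<mu>)
       \<le> (\<integral>\<^sup>+z. ennreal (norm (fst z - snd z) powr q) \<partial>(\<mu> \<Otimes>\<^sub>M \<mu>))"
proof -
  define g where "g x = ennreal (max 0 (norm (x - x0) - \<delta>) powr q)" for x
  define i where "i x = (indicator (ball x0 \<delta>) x :: ennreal)" for x
  note m = borel_measurable_prob_measures_on[OF \<mu>]
  have [measurable]: "g \<in> borel_measurable \<mu>" unfolding g_def by (rule m) measurable
  have [measurable]: "i \<in> borel_measurable \<mu>"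
    unfolding i_def by (intro m borel_measurable_indicator) auto
  have I: "integral\<^sup>N \<mu> i = emeasure \<mu> (\<Omega> \<inter> ball x0 \<delta>)"
  proof -
    have "\<Omega> \<inter> ball x0 \<delta> \<in> sets \<mu>"
      by (auto simp: prob_measures_onD(2)[OF \<mu>] sets_restrict_space)
    moreover have "integral\<^sup>N \<mu> i = (\<integral>\<^sup>+x. indicator (\<Omega> \<inter> ball x0 \<delta>) x \<partial>\<mu>)"
      by (rule nn_integral_cong) (simp add: i_def prob_measures_onD(4)[OF \<mu>] indicator_def)
    ultimately show ?thesis by simp
  qed
  \<comment> \<open>When both points are in the ball both summands vanish, since \<open>g\<close> is
    0 there; so no pair is counted twice.\<close>
  have "i x * g y + i y * g x \<le> ennreal (norm (x - y) powr q)" for x y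
  proof -
    have "g x \<le> ennreal (norm (x - y) powr q)" if "norm (y - x0) < \<delta>"
      unfolding g_def using that \<open>q > 0\<close> norm_triangle_ineq[of "x - y" "y - x0"]
      by (intro ennreal_leI powr_mono2) auto
    moreover have "g y \<le> ennreal (norm (x - y) powr q)" if "norm (x - x0) < \<delta>"
      unfolding g_def using that \<open>q > 0\<close> norm_triangle_ineq[of "y - x" "x - x0"]
      by (intro ennreal_leI powr_mono2) (auto simp: norm_minus_commute)
    moreover have "g z = 0" if "norm (z - x0) < \<delta>" for z using that by (simp add: g_def)
    ultimately show ?thesis
      by (auto simp: i_def indicator_def dist_norm norm_minus_commute)
  qed
  then have le: "(\<integral>\<^sup>+x. (\<integral>\<^sup>+y. i x * g y + i y * g x \<partial>\<mu>) \<partial>\<mu>)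
      \<le> (\<integral>\<^sup>+x. (\<integral>\<^sup>+y. ennreal (norm (x - y) powr q) \<partial>\<mu>) \<partial>\<mu>)"
    by (intro nn_integral_mono)
  have "(\<integral>\<^sup>+x. (\<integral>\<^sup>+y. i x * g y + i y * g x \<partial>\<mu>) \<partial>\<mu>) = 2 * integral\<^sup>N \<mu> i * integral\<^sup>N \<mu> g"
    by (simp add: nn_integral_add nn_integral_cmult nn_integral_multc distrib_right flip: mult_2)
      (simp add: mult.assoc)
  with le show ?thesis
    unfolding nn_integral_interaction[OF \<mu>] g_def[symmetric] I by simp
qed

text \<open>The interaction between the mass \<open>c\<close> near \<open>x0\<close> and the mass away from it is linear in the
  density, so minimising the integrand pointwise bounds the functional below for fixed \<open>\<epsilon>\<close>.\<close>

lemma G_functional_ge: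
  fixes \<Omega> :: "'a::euclidean_space set"
  assumes "closed \<Omega>" and \<mu>: "\<mu> \<in> prob_measures_on \<Omega>"
    and [measurable]: "\<rho> \<in> borel_measurable (restrict_space lborel \<Omega>)"
    and \<rho>0: "\<And>x. x \<in> \<Omega> \<Longrightarrow> 0 \<le> \<rho> x"
    and "p > 0" "q > 0" "\<epsilon> > 0" "c \<ge> 0"
    and c: "ennreal c \<le> emeasure \<mu> (\<Omega> \<inter> ball x0 \<delta>)"
    and t: "t = p / real DIM('a)"
  shows "(\<integral>\<^sup>+x. ennreal ((1 + t) * (2 * c / t) powr (t / (1 + t)) *
             (\<rho> x powr (1 / (1 + t)) * max 0 (norm (x - x0) - \<delta>) powr (t / (1 + t) * q))) \<partial>restrict_space lborel \<Omega>)
           \<le> G_functional \<Omega> \<rho> p q \<epsilon> \<mu>"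
proof -
  let ?L = "restrict_space lborel \<Omega>"
  define \<alpha> \<beta> where "\<alpha> = t / (1 + t)" and "\<beta> = 1 / (1 + t)"
  define u where "u = ac_density ?L \<mu>"
  define g where "g x = max 0 (norm (x - x0) - \<delta>) powr q" for x
  \<comment> \<open>The coefficient \<open>b * g x\<close> is what multiplies the density at
    \<open>x\<close> in the lower bound for the interaction term.\<close>
  define b where "b = \<epsilon> powr (- \<beta>) * (2 * c)"
  have "t > 0" using assms by simp
  have ac: "is_ac_density ?L \<mu> u"
    unfolding u_def using assms(1) \<mu> by (rule ac_density_prob_measure)
  then have [measurable]: "u \<in> borel_measurable ?L" and u0: "\<And>x. u x \<ge> 0"
    by (auto simp: is_ac_density_def)
  have "g \<in> borel_measurable lborel" unfolding g_def by measurable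
  then have [measurable]: "g \<in> borel_measurable ?L" by (rule measurable_restrict_space1)
  have b: "b \<ge> 0" using \<open>c \<ge> 0\<close> by (simp add: b_def)
  have g0: "g x \<ge> 0" for x by (simp add: g_def)
  have "(\<integral>\<^sup>+x. ennreal ((1 + t) * (2 * c / t) powr \<alpha> *
             (\<rho> x powr \<beta> * max 0 (norm (x - x0) - \<delta>) powr (\<alpha> * q))) \<partial>?L)
      \<le> (\<integral>\<^sup>+x. ennreal (\<epsilon> powr \<alpha>) * cost_integrand t (\<rho> x) (u x) + ennreal b * (ennreal (u x) * ennreal (g x)) \<partial>?L)"
  proof (rule nn_integral_mono)
    fix x assume "x \<in> space ?L"
    then have x: "x \<in> \<Omega>" by (simp add: space_restrict_space)
    \<comment> \<open>Raised to the Young weights, the two prefactors become mutually inverse powers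
      of \<open>\<epsilon>\<close>. This is where the choice of the exponents makes the bound
      independent of \<open>\<epsilon>\<close>.\<close>
    have "(b * g x / t) powr \<alpha> * (\<epsilon> powr \<alpha> * \<rho> x) powr \<beta>
        = (\<epsilon> powr (- \<beta> * \<alpha>) * \<epsilon> powr (\<alpha> * \<beta>)) * ((2 * c / t) powr \<alpha> * (\<rho> x powr \<beta> * g x powr \<alpha>))"
      using \<open>t > 0\<close> \<open>c \<ge> 0\<close> g0 \<rho>0[OF x] by (simp add: b_def powr_mult powr_divide powr_powr)
    also have "\<epsilon> powr (- \<beta> * \<alpha>) * \<epsilon> powr (\<alpha> * \<beta>) = 1"
      using \<open>\<epsilon> > 0\<close> by (simp flip: powr_add)
    also have "g x powr \<alpha> = max 0 (norm (x - x0) - \<delta>) powr (\<alpha> * q)"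
      by (simp add: g_def powr_powr mult.commute)
    finally have "ennreal ((1 + t) * (2 * c / t) powr \<alpha> * (\<rho> x powr \<beta> * max 0 (norm (x - x0) - \<delta>) powr (\<alpha> * q)))
        = ennreal ((1 + t) * (b * g x / t) powr \<alpha> * (\<epsilon> powr \<alpha> * \<rho> x) powr \<beta>)"
      by (simp add: mult.assoc)
    also have "\<dots> \<le> ennreal (\<epsilon> powr \<alpha>) * cost_integrand t (\<rho> x) (u x) + ennreal (b * g x * u x)"
      unfolding \<alpha>_def \<beta>_def
      by (rule cost_integrand_lower_bound) (use \<open>t > 0\<close> \<open>\<epsilon> > 0\<close> \<rho>0[OF x] b g0 u0 in auto)
    also have "ennreal (b * g x * u x) = ennreal b * (ennreal (u x) * ennreal (g x))"
      using b g0 u0 by (simp add: ennreal_mult ac_simps)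
    finally show "ennreal ((1 + t) * (2 * c / t) powr \<alpha> * (\<rho> x powr \<beta> * max 0 (norm (x - x0) - \<delta>) powr (\<alpha> * q)))
       \<le> ennreal (\<epsilon> powr \<alpha>) * cost_integrand t (\<rho> x) (u x) + ennreal b * (ennreal (u x) * ennreal (g x))" .
  qed
  also have "\<dots> = ennreal (\<epsilon> powr \<alpha>) * (\<integral>\<^sup>+x. cost_integrand t (\<rho> x) (u x) \<partial>?L)
      + ennreal b * (\<integral>\<^sup>+x. ennreal (u x) * ennreal (g x) \<partial>?L)"
    by (simp add: nn_integral_add nn_integral_cmult)
  also have "\<dots> \<le> ennreal (\<epsilon> powr \<alpha>) * (\<integral>\<^sup>+x. cost_integrand t (\<rho> x) (u x) \<partial>?L)
      + ennreal (\<epsilon> powr (- \<beta>)) * (\<integral>\<^sup>+z. ennreal (norm (fst z - snd z) powr q) \<partial>(\<mu> \<Otimes>\<^sub>M \<mu>))"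
  proof (rule add_left_mono)
    \<comment> \<open>Pass from the density to all of \<open>\<mu>\<close>, then from
      \<open>c\<close> to the mass of the ball, and finally to the full interaction.\<close>
    have "ennreal b * (\<integral>\<^sup>+x. ennreal (u x) * ennreal (g x) \<partial>?L) \<le> ennreal b * (\<integral>\<^sup>+x. ennreal (g x) \<partial>\<mu>)"
      by (intro mult_left_mono nn_integral_ac_density_le ac prob_measures_onD(3)[OF \<mu>]) simp_all
    also have "\<dots> = ennreal (\<epsilon> powr (- \<beta>)) * (2 * ennreal c * (\<integral>\<^sup>+x. ennreal (g x) \<partial>\<mu>))"
      using \<open>c \<ge> 0\<close> by (simp add: b_def ennreal_mult mult.assoc)
    also have "\<dots> \<le> ennreal (\<epsilon> powr (- \<beta>)) * (2 * emeasure \<mu> (\<Omega> \<inter> ball x0 \<delta>) * (\<integral>\<^sup>+x. ennreal (g x) \<partial>\<mu>))"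
      by (intro mult_left_mono mult_right_mono c) simp_all
    also have "\<dots> \<le> ennreal (\<epsilon> powr (- \<beta>)) * (\<integral>\<^sup>+z. ennreal (norm (fst z - snd z) powr q) \<partial>(\<mu> \<Otimes>\<^sub>M \<mu>))"
      unfolding g_def by (intro mult_left_mono interaction_ge_tail[OF \<mu> \<open>q > 0\<close>]) simp
    finally show "ennreal b * (\<integral>\<^sup>+x. ennreal (u x) * ennreal (g x) \<partial>?L)
      \<le> ennreal (\<epsilon> powr (- \<beta>)) * (\<integral>\<^sup>+z. ennreal (norm (fst z - snd z) powr q) \<partial>(\<mu> \<Otimes>\<^sub>M \<mu>))" .
  qed
  also have "\<dots> = G_functional \<Omega> \<rho> p q \<epsilon> \<mu>"
    by (simp add: G_functional_def Let_def nn_integral_lebesgue_on_lborel[OF assms(1)] u_def \<alpha>_def \<beta>_def t)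
  finally show ?thesis by (simp add: \<alpha>_def \<beta>_def)
qed

section \<open>Hat functions and the liminf inequality at Dirac masses\<close>

lemma continuous_on_hat: "continuous_on A (\<lambda>w. max 0 (1 - dist w z / \<delta>))" for \<delta> :: real
  unfolding divide_inverse by (intro continuous_intros)

text \<open>Weak* convergence tests only continuous functions, which excludes indicators of balls. A
  hat is a continuous function below such an indicator, so limits of its integrals still give lower
  bounds for masses of balls.\<close>

lemma integral_hat_le:
  fixes z :: "'a::euclidean_space"
  assumes "compact \<Omega>" "\<mu> \<in> prob_measures_on \<Omega>" "\<delta> > 0"
  shows "ennreal (\<integral>w. max 0 (1 - dist w z / \<delta>) \<partial>\<mu>) \<le> emeasure \<mu> (\<Omega> \<inter> ball z \<delta>)"
proof -
  have "ennreal (\<integral>w. max 0 (1 - dist w z / \<delta>) \<partial>\<mu>) = (\<integral>\<^sup>+w. ennreal (max 0 (1 - dist w z / \<delta>)) \<partial>\<mu>)"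
    using integrable_continuous_on_compact[OF assms(1,2) continuous_on_hat]
    by (intro nn_integral_eq_integral[symmetric]) auto
  also have "\<dots> \<le> (\<integral>\<^sup>+w. indicator (\<Omega> \<inter> ball z \<delta>) w \<partial>\<mu>)"
    using \<open>\<delta> > 0\<close>
    by (intro nn_integral_mono)
      (auto simp: prob_measures_onD(4)[OF assms(2)] indicator_def dist_commute max_def)
  also have "\<dots> = emeasure \<mu> (\<Omega> \<inter> ball z \<delta>)"
    by (intro nn_integral_indicator) (auto simp: prob_measures_onD(2)[OF assms(2)] sets_restrict_space)
  finally show ?thesis .
qed

lemma integral_dirac_on:
  fixes f :: "'a::euclidean_space \<Rightarrow> real"
  assumes "x \<in> \<Omega>" "continuous_on \<Omega> f"
  shows "(\<integral>y. f y \<partial>dirac_on \<Omega> x) = f x"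
  unfolding dirac_on_def using assms borel_measurable_continuous_on_restrict[OF assms(2)]
  by (intro integral_return) (auto simp: space_restrict_space)

text \<open>The mass near \<open>x0\<close> tends to 1, so the bound for fixed
  \<open>\<epsilon>\<close> eventually holds with any \<open>c < 1\<close> and any radius
  \<open>\<delta> > 0\<close>. Letting \<open>c\<close> tend to 1 and \<open>\<delta>\<close> to 0,
  Fatou's lemma yields the limit functional.\<close>

lemma Liminf_dirac:
  fixes \<Omega> :: "'a::euclidean_space set"
  assumes "compact \<Omega>" and x0: "x0 \<in> \<Omega>"
    and [measurable]: "\<rho> \<in> borel_measurable (restrict_space lborel \<Omega>)"
    and \<rho>0: "\<And>x. x \<in> \<Omega> \<Longrightarrow> 0 \<le> \<rho> x"
    and "p > 0" "q > 0"
    and m: "\<And>\<epsilon>. \<epsilon> > 0 \<Longrightarrow> m \<epsilon> \<in> prob_measures_on \<Omega>"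
    and conv: "weak_star_tendsto \<Omega> m (dirac_on \<Omega> x0)"
  shows "H_dirac \<Omega> \<rho> p q x0 \<le> Liminf (at_right 0) (\<lambda>\<epsilon>. G_functional \<Omega> \<rho> p q \<epsilon> (m \<epsilon>))"
proof -
  let ?L = "restrict_space lborel \<Omega>"
  have cl: "closed \<Omega>" using assms(1) by (rule compact_imp_closed)
  define t where "t = p / real DIM('a)"
  define \<alpha> \<beta> where "\<alpha> = t / (1 + t)" and "\<beta> = 1 / (1 + t)"
  have t: "t > 0" using \<open>p > 0\<close> by (simp add: t_def)
  have \<alpha>: "\<alpha> > 0" using t by (simp add: \<alpha>_def)
  \<comment> \<open>Strictness of \<open>c n < 1\<close> matters: the hat integral only converges to
    1, hence eventually exceeds \<open>c n\<close>.\<close>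
  define c where "c n = 1 - 1 / (real n + 2)" for n
  define \<delta> where "\<delta> n = 1 / (real n + 2)" for n
  define h where "h n x = ennreal ((1 + t) * (2 * c n / t) powr \<alpha> *
             (\<rho> x powr \<beta> * max 0 (norm (x - x0) - \<delta> n) powr (\<alpha> * q)))" for n x
  have hle: "(\<integral>\<^sup>+x. h n x \<partial>?L) \<le> Liminf (at_right 0) (\<lambda>\<epsilon>. G_functional \<Omega> \<rho> p q \<epsilon> (m \<epsilon>))" for n
  proof (rule Liminf_bounded)
    have pos: "\<delta> n > 0" "c n \<ge> 0" "c n < 1" by (auto simp: \<delta>_def c_def)
    have "((\<lambda>\<epsilon>. \<integral>w. max 0 (1 - dist w x0 / \<delta> n) \<partial>m \<epsilon>) \<longlongrightarrow> 1) (at_right 0)"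
      using conv continuous_on_hat[of \<Omega> x0 "\<delta> n"] x0
      by (fastforce simp: weak_star_tendsto_def integral_dirac_on)
    from order_tendstoD(1)[OF this \<open>c n < 1\<close>]
    show "\<forall>\<^sub>F \<epsilon> in at_right 0. (\<integral>\<^sup>+x. h n x \<partial>?L) \<le> G_functional \<Omega> \<rho> p q \<epsilon> (m \<epsilon>)"
      using eventually_at_right_less[of 0]
    proof eventually_elim
      case (elim \<epsilon>)
      have "ennreal (c n) \<le> ennreal (\<integral>w. max 0 (1 - dist w x0 / \<delta> n) \<partial>m \<epsilon>)"
        using elim by (intro ennreal_leI) simp
      also have "\<dots> \<le> emeasure (m \<epsilon>) (\<Omega> \<inter> ball x0 (\<delta> n))"
        using elim by (intro integral_hat_le assms(1) m pos)
      finally show ?case unfolding h_def \<alpha>_def \<beta>_def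
        using elim by (intro G_functional_ge[OF cl m _ \<rho>0 \<open>p > 0\<close> \<open>q > 0\<close> _ pos(2)]) (auto simp: t_def)
    qed
  qed
  have [measurable]: "(\<lambda>x. norm (x - y)) \<in> borel_measurable ?L" for y
    by (rule measurable_restrict_space1) simp
  have [measurable]: "h n \<in> borel_measurable ?L" for n
    unfolding h_def by measurable
  have lim: "(\<lambda>n. h n x) \<longlonglongrightarrow> ennreal ((1 + t) * (2 / t) powr \<alpha> * (\<rho> x powr \<beta> * norm (x - x0) powr (\<alpha> * q)))" for x
  proof -
    have "c \<longlonglongrightarrow> 1" "\<delta> \<longlonglongrightarrow> 0" unfolding c_def \<delta>_def by real_asymp+
    \<comment> \<open>At \<open>x = x0\<close> the base of the last power tends to 0; positivity of
      the exponent gives continuity there.\<close>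
    then have "(\<lambda>n. (1 + t) * (2 * c n / t) powr \<alpha> * (\<rho> x powr \<beta> * max 0 (norm (x - x0) - \<delta> n) powr (\<alpha> * q)))
      \<longlonglongrightarrow> (1 + t) * (2 * 1 / t) powr \<alpha> * (\<rho> x powr \<beta> * max 0 (norm (x - x0) - 0) powr (\<alpha> * q))"
      using \<alpha> \<open>q > 0\<close> t by (intro tendsto_intros tendsto_powr2) auto
    then show ?thesis unfolding h_def by (intro tendsto_ennrealI) simp
  qed
  have "H_dirac \<Omega> \<rho> p q x0 = ennreal ((1 + t) * (2 / t) powr \<alpha>) * (\<integral>\<^sup>+x. ennreal (\<rho> x powr \<beta> * norm (x - x0) powr (\<alpha> * q)) \<partial>?L)"
    by (simp add: H_dirac_def Let_def nn_integral_lebesgue_on_lborel[OF cl] \<alpha>_def \<beta>_def t_def)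
  also have "\<dots> = (\<integral>\<^sup>+x. ennreal ((1 + t) * (2 / t) powr \<alpha> * (\<rho> x powr \<beta> * norm (x - x0) powr (\<alpha> * q))) \<partial>?L)"
    using t by (subst nn_integral_cmult[symmetric]) (simp_all add: ennreal_mult)
  also have "\<dots> = (\<integral>\<^sup>+x. liminf (\<lambda>n. h n x) \<partial>?L)"
    using lim_imp_Liminf[OF _ lim] by simp
  \<comment> \<open>Fatou's lemma in \<open>n\<close>. Each integral is below the same Liminf over
    \<open>\<epsilon>\<close>, so the liminf on the right in the next step is that of a constant
    sequence.\<close>
  also have "\<dots> \<le> liminf (\<lambda>n. \<integral>\<^sup>+x. h n x \<partial>?L)"
    by (rule nn_integral_liminf) simp
  also have "\<dots> \<le> liminf (\<lambda>n. Liminf (at_right 0) (\<lambda>\<epsilon>. G_functional \<Omega> \<rho> p q \<epsilon> (m \<epsilon>)))"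
    by (intro Liminf_mono always_eventually allI hle)
  finally show ?thesis by (simp add: Liminf_const)
qed

section \<open>Blow-up when the limit is not a Dirac mass\<close>

text \<open>The Lindelof property reduces the cover by null balls to a countable one.
  Contrapositively, every set of positive measure contains a point all of whose neighbourhoods have
  positive mass.\<close>

lemma emeasure_eq_0_locally:
  fixes \<Omega> :: "'a::euclidean_space set"
  assumes \<mu>: "\<mu> \<in> prob_measures_on \<Omega>" and U: "U \<subseteq> \<Omega>"
    and loc: "\<And>x. x \<in> U \<Longrightarrow> \<exists>\<delta>>0. emeasure \<mu> (\<Omega> \<inter> ball x \<delta>) = 0"
  shows "emeasure \<mu> U = 0"
proof -
  obtain d where d: "\<And>x. x \<in> U \<Longrightarrow> d x > 0 \<and> emeasure \<mu> (\<Omega> \<inter> ball x (d x)) = 0"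
    using loc by metis
  obtain \<F> where F: "\<F> \<subseteq> (\<lambda>x. ball x (d x)) ` U" "countable \<F>" "\<Union>\<F> = (\<Union>x\<in>U. ball x (d x))"
    using Lindelof[of "(\<lambda>x. ball x (d x)) ` U"] by auto
  have "(\<Union>B\<in>\<F>. \<Omega> \<inter> B) \<in> null_sets \<mu>"
  proof (rule null_sets_UN')
    fix B assume "B \<in> \<F>"
    then obtain x where "x \<in> U" "B = ball x (d x)" using F by auto
    then show "\<Omega> \<inter> B \<in> null_sets \<mu>"
      using d by (auto simp: null_sets_def prob_measures_onD(2)[OF \<mu>] sets_restrict_space)
  qed fact
  moreover have "U \<subseteq> (\<Union>B\<in>\<F>. \<Omega> \<inter> B)"
  proof
    fix x assume "x \<in> U"
    then have "x \<in> \<Union>\<F>" unfolding F(3) using d centre_in_ball by blast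
    then show "x \<in> (\<Union>B\<in>\<F>. \<Omega> \<inter> B)" using \<open>x \<in> U\<close> U by auto
  qed
  ultimately show ?thesis
    by (metis emeasure_mono le_zero_eq null_setsD1 null_setsD2)
qed

lemma eq_dirac_on:
  fixes \<Omega> :: "'a::euclidean_space set"
  assumes \<mu>: "\<mu> \<in> prob_measures_on \<Omega>" and x: "x \<in> \<Omega>" and 0: "emeasure \<mu> (\<Omega> - {x}) = 0"
  shows "\<mu> = dirac_on \<Omega> x"
proof (rule measure_eqI)
  interpret prob_space \<mu> by (rule prob_measures_onD(1)[OF \<mu>])
  show "sets \<mu> = sets (dirac_on \<Omega> x)"
    by (simp add: dirac_on_def prob_measures_onD(2)[OF \<mu>])
  have sp: "space \<mu> = \<Omega>" by (rule prob_measures_onD(4)[OF \<mu>])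
  have "{x} = \<Omega> \<inter> {x}" using x by blast
  also have "\<dots> \<in> sets \<mu>" by (auto simp: prob_measures_onD(2)[OF \<mu>] sets_restrict_space)
  finally have s: "\<Omega> - {x} \<in> sets \<mu>" using sp sets.compl_sets by metis
  then have null: "\<Omega> - {x} \<in> null_sets \<mu>" using 0 by auto
  fix A assume A: "A \<in> sets \<mu>"
  have "emeasure \<mu> A = (if x \<in> A then 1 else 0)"
  proof (cases "x \<in> A")
    case True
    have "AE y in \<mu>. y \<in> A"
      by (rule AE_I'[OF null]) (use True sp in auto)
    then show ?thesis using A True emeasure_eq_1_AE by auto
  next
    case False
    have "A \<subseteq> \<Omega> - {x}" using False sets.sets_into_space[OF A] sp by auto
    then have "emeasure \<mu> A \<le> emeasure \<mu> (\<Omega> - {x})" using s by (intro emeasure_mono)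
    then show ?thesis using False 0 by simp
  qed
  then show "emeasure \<mu> A = emeasure (dirac_on \<Omega> x) A"
    using A by (simp add: dirac_on_def prob_measures_onD(2)[OF \<mu>] indicator_def)
qed

text \<open>The first support point comes from \<open>\<Omega>\<close>, which has mass 1. The second
  comes from the complement of the first, which has positive mass because otherwise
  \<open>\<mu>\<close> would be the Dirac mass there.\<close>

lemma non_dirac_two_support_points:
  fixes \<Omega> :: "'a::euclidean_space set"
  assumes \<mu>: "\<mu> \<in> prob_measures_on \<Omega>" and nd: "\<And>x. x \<in> \<Omega> \<Longrightarrow> \<mu> \<noteq> dirac_on \<Omega> x"
  obtains x y where "x \<noteq> y"
    "\<And>\<delta>. \<delta> > 0 \<Longrightarrow> emeasure \<mu> (\<Omega> \<inter> ball x \<delta>) > 0"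
    "\<And>\<delta>. \<delta> > 0 \<Longrightarrow> emeasure \<mu> (\<Omega> \<inter> ball y \<delta>) > 0"
proof -
  interpret prob_space \<mu> by (rule prob_measures_onD(1)[OF \<mu>])
  have "emeasure \<mu> \<Omega> = 1" using emeasure_space_1 prob_measures_onD(4)[OF \<mu>] by simp
  then obtain x where x: "x \<in> \<Omega>" "\<And>\<delta>. \<delta> > 0 \<Longrightarrow> emeasure \<mu> (\<Omega> \<inter> ball x \<delta>) > 0"
    using emeasure_eq_0_locally[OF \<mu>, of \<Omega>] zero_less_iff_neq_zero by (metis order_refl zero_neq_one)
  have "emeasure \<mu> (\<Omega> - {x}) \<noteq> 0" using eq_dirac_on[OF \<mu> x(1)] nd[OF x(1)] by blast
  then obtain y where "y \<in> \<Omega> - {x}" "\<And>\<delta>. \<delta> > 0 \<Longrightarrow> emeasure \<mu> (\<Omega> \<inter> ball y \<delta>) > 0"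
    using emeasure_eq_0_locally[OF \<mu>, of "\<Omega> - {x}"] zero_less_iff_neq_zero by (metis Diff_subset)
  with x that show ?thesis by blast
qed

text \<open>Centres at distance \<open>4 * \<delta>\<close> leave a gap of at least
  \<open>2 * \<delta>\<close> between points of the two balls of radius \<open>\<delta>\<close>.
  Hats replace indicators so that the lower bound passes to weak* limits.\<close>

lemma interaction_ge_hats:
  fixes x y :: "'a::euclidean_space"
  assumes \<Omega>: "compact \<Omega>" and \<mu>: "\<mu> \<in> prob_measures_on \<Omega>" and "q > 0" "\<delta> > 0" and d: "dist x y = 4 * \<delta>"
  shows "ennreal ((2 * \<delta>) powr q * (\<integral>w. max 0 (1 - dist w x / \<delta>) \<partial>\<mu>) * (\<integral>w. max 0 (1 - dist w y / \<delta>) \<partial>\<mu>))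
       \<le> (\<integral>\<^sup>+z. ennreal (norm (fst z - snd z) powr q) \<partial>(\<mu> \<Otimes>\<^sub>M \<mu>))"
proof -
  define f where "f z w = max 0 (1 - dist w z / \<delta>)" for z w :: 'a
  have f0: "f z w \<ge> 0" for z w by (simp add: f_def)
  have i: "integrable \<mu> (f z)" for z
    unfolding f_def using \<Omega> \<mu> continuous_on_hat by (rule integrable_continuous_on_compact)
  have [measurable]: "f z \<in> borel_measurable \<mu>" for z using i by auto
  have eq: "(\<integral>\<^sup>+w. ennreal (f z w) \<partial>\<mu>) = ennreal (\<integral>w. f z w \<partial>\<mu>)" for z
    using i f0 by (intro nn_integral_eq_integral) auto
  have "ennreal ((2 * \<delta>) powr q * (\<integral>w. f x w \<partial>\<mu>) * (\<integral>w. f y w \<partial>\<mu>))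
      = (\<integral>\<^sup>+w. (\<integral>\<^sup>+v. ennreal ((2 * \<delta>) powr q) * (ennreal (f x w) * ennreal (f y v)) \<partial>\<mu>) \<partial>\<mu>)"
    by (simp add: nn_integral_cmult nn_integral_multc eq ennreal_mult f0 mult.assoc)
  also have "\<dots> \<le> (\<integral>\<^sup>+w. (\<integral>\<^sup>+v. ennreal (norm (w - v) powr q) \<partial>\<mu>) \<partial>\<mu>)"
  proof (intro nn_integral_mono)
    fix w v
    have f1: "f z u \<le> 1" and fz: "dist u z \<ge> \<delta> \<Longrightarrow> f z u = 0" for z u
      using \<open>\<delta> > 0\<close> by (auto simp: f_def)
    have "(2 * \<delta>) powr q * (f x w * f y v) \<le> norm (w - v) powr q"
    proof (cases "dist w x \<ge> \<delta> \<or> dist v y \<ge> \<delta>")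
      case True
      then show ?thesis using fz by auto
    next
      case False
      then have "2 * \<delta> \<le> norm (w - v)"
        using d dist_triangle[of x y w] dist_triangle[of w y v]
        by (simp add: dist_commute dist_norm[symmetric])
      then have "(2 * \<delta>) powr q \<le> norm (w - v) powr q"
        using \<open>\<delta> > 0\<close> \<open>q > 0\<close> by (intro powr_mono2) auto
      moreover have "f x w * f y v \<le> 1" using f0 f1 by (intro mult_le_one)
      ultimately show ?thesis
        using mult_mono[of "(2 * \<delta>) powr q" "norm (w - v) powr q" "f x w * f y v" 1] f0 by simp
    qed
    then show "ennreal ((2 * \<delta>) powr q) * (ennreal (f x w) * ennreal (f y v)) \<le> ennreal (norm (w - v) powr q)"
      using f0 by (simp add: ennreal_leI flip: ennreal_mult)
  qed
  finally show ?thesis unfolding nn_integral_interaction[OF \<mu>] f_def .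
qed

text \<open>The hat is strictly positive on the open ball, so a vanishing integral would make the
  ball a null set.\<close>

lemma integral_hat_pos:
  fixes z :: "'a::euclidean_space"
  assumes \<Omega>: "compact \<Omega>" and \<mu>: "\<mu> \<in> prob_measures_on \<Omega>" and "\<delta> > 0"
    and pos: "emeasure \<mu> (\<Omega> \<inter> ball z \<delta>) > 0"
  shows "(\<integral>w. max 0 (1 - dist w z / \<delta>) \<partial>\<mu>) > 0"
proof -
  have int: "integrable \<mu> (\<lambda>w. max 0 (1 - dist w z / \<delta>))"
    using \<Omega> \<mu> continuous_on_hat by (rule integrable_continuous_on_compact)
  have "(\<integral>w. max 0 (1 - dist w z / \<delta>) \<partial>\<mu>) \<noteq> 0"
  proof
    assume "(\<integral>w. max 0 (1 - dist w z / \<delta>) \<partial>\<mu>) = 0"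
    then have "AE w in \<mu>. max 0 (1 - dist w z / \<delta>) = 0"
      using integral_nonneg_eq_0_iff_AE[OF int] by simp
    then have "AE w in \<mu>. w \<notin> \<Omega> \<inter> ball z \<delta>"
    proof eventually_elim
      case (elim w)
      then have "1 \<le> dist w z / \<delta>" by linarith
      then show ?case using \<open>\<delta> > 0\<close> by (simp add: dist_commute)
    qed
    then have "emeasure \<mu> (\<Omega> \<inter> ball z \<delta>) = 0"
      by (subst (asm) AE_iff_null_sets[symmetric])
        (auto simp: prob_measures_onD(2)[OF \<mu>] sets_restrict_space null_sets_def)
    with pos show False by simp
  qed
  moreover have "(\<integral>w. max 0 (1 - dist w z / \<delta>) \<partial>\<mu>) \<ge> 0" by simp
  ultimately show ?thesis by linarith
qed

lemma Liminf_non_dirac: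
  fixes \<Omega> :: "'a::euclidean_space set"
  assumes \<Omega>: "compact \<Omega>" and \<mu>: "\<mu> \<in> prob_measures_on \<Omega>"
    and nd: "\<And>x. x \<in> \<Omega> \<Longrightarrow> \<mu> \<noteq> dirac_on \<Omega> x"
    and "p > 0" "q > 0"
    and m: "\<And>\<epsilon>. \<epsilon> > 0 \<Longrightarrow> m \<epsilon> \<in> prob_measures_on \<Omega>"
    and conv: "weak_star_tendsto \<Omega> m \<mu>"
  shows "Liminf (at_right 0) (\<lambda>\<epsilon>. G_functional \<Omega> \<rho> p q \<epsilon> (m \<epsilon>)) = \<infinity>"
proof -
  obtain x y where "x \<noteq> y" and
    xy: "\<And>\<delta>. \<delta> > 0 \<Longrightarrow> emeasure \<mu> (\<Omega> \<inter> ball x \<delta>) > 0" "\<And>\<delta>. \<delta> > 0 \<Longrightarrow> emeasure \<mu> (\<Omega> \<inter> ball y \<delta>) > 0"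
    using non_dirac_two_support_points[OF \<mu> nd] by blast
  define \<delta> where "\<delta> = dist x y / 4"
  define \<beta> where "\<beta> = 1 / (1 + p / real DIM('a))"
  have \<beta>: "\<beta> > 0" using \<open>p > 0\<close> by (simp add: \<beta>_def add_pos_pos)
  have \<delta>: "\<delta> > 0" "dist x y = 4 * \<delta>" using \<open>x \<noteq> y\<close> by (auto simp: \<delta>_def)
  \<comment> \<open>A lower bound for the interaction that is continuous along \<open>m\<close>,
    being a constant times a product of two integrals of continuous functions.\<close>
  define I where "I M = (2 * \<delta>) powr q * (\<integral>w. max 0 (1 - dist w x / \<delta>) \<partial>M) * (\<integral>w. max 0 (1 - dist w y / \<delta>) \<partial>M)" for M
  have I0: "I \<mu> > 0"
    unfolding I_def using \<delta> xy[of \<delta>] by (intro mult_pos_pos integral_hat_pos[OF \<Omega> \<mu>]) auto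
  have "((\<lambda>\<epsilon>. I (m \<epsilon>)) \<longlongrightarrow> I \<mu>) (at_right 0)"
    unfolding I_def using conv continuous_on_hat
    by (intro tendsto_intros) (auto simp: weak_star_tendsto_def)
  then have ev: "\<forall>\<^sub>F \<epsilon> in at_right 0. I (m \<epsilon>) > I \<mu> / 2"
    using I0 by (intro order_tendstoD) auto
  have "of_nat n \<le> Liminf (at_right 0) (\<lambda>\<epsilon>. G_functional \<Omega> \<rho> p q \<epsilon> (m \<epsilon>))" for n
  proof (rule Liminf_bounded)
    \<comment> \<open>The interaction eventually stays above \<open>I \<mu> / 2\<close>, so its
      prefactor drives the functional beyond every natural number; the nonnegative first term is
      dropped.\<close>
    have "filterlim (\<lambda>\<epsilon>::real. \<epsilon> powr (- \<beta>) * (I \<mu> / 2)) at_top (at_right 0)"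
      using \<beta> I0 by real_asymp
    then have "\<forall>\<^sub>F \<epsilon> in at_right 0. real n \<le> \<epsilon> powr (- \<beta>) * (I \<mu> / 2)"
      by (simp add: filterlim_at_top)
    then show "\<forall>\<^sub>F \<epsilon> in at_right 0. of_nat n \<le> G_functional \<Omega> \<rho> p q \<epsilon> (m \<epsilon>)"
      using ev eventually_at_right_less[of 0]
    proof eventually_elim
      case (elim \<epsilon>)
      have "\<epsilon> powr (- \<beta>) * (I \<mu> / 2) \<le> \<epsilon> powr (- \<beta>) * I (m \<epsilon>)"
        using elim by (intro mult_left_mono) auto
      with elim(1) have "real n \<le> \<epsilon> powr (- \<beta>) * I (m \<epsilon>)" by linarith
      then have "of_nat n \<le> ennreal (\<epsilon> powr (- \<beta>) * I (m \<epsilon>))"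
        by (simp add: ennreal_of_nat_eq_real_of_nat ennreal_leI)
      also have "\<dots> = ennreal (\<epsilon> powr (- \<beta>)) * ennreal (I (m \<epsilon>))"
        using elim I0 by (intro ennreal_mult) auto
      also have "\<dots> \<le> ennreal (\<epsilon> powr (- \<beta>)) * (\<integral>\<^sup>+z. ennreal (norm (fst z - snd z) powr q) \<partial>(m \<epsilon> \<Otimes>\<^sub>M m \<epsilon>))"
        unfolding I_def using elim \<delta>
        by (intro mult_left_mono interaction_ge_hats[OF \<Omega> m \<open>q > 0\<close>]) auto
      also have "\<dots> \<le> G_functional \<Omega> \<rho> p q \<epsilon> (m \<epsilon>)"
        by (simp add: G_functional_def Let_def \<beta>_def)
      finally show ?case .
    qed
  qed
  then show ?thesis
    using ennreal_Ex_less_of_nat[of "Liminf (at_right 0) (\<lambda>\<epsilon>. G_functional \<Omega> \<rho> p q \<epsilon> (m \<epsilon>))"]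
    by (metis infinity_ennreal_def leD top.not_eq_extremum)
qed

section \<open>Recovery sequence\<close>

text \<open>The atom carries the mass missing from \<open>w\<close>. This gives a probability
  measure only if \<open>w\<close> has integral at most 1, since \<open>ennreal\<close> maps
  negative numbers to 0.\<close>

definition recovery_measure :: "'a::euclidean_space set \<Rightarrow> 'a \<Rightarrow> ('a \<Rightarrow> real) \<Rightarrow> 'a measure" where
  "recovery_measure \<Omega> x0 w =
     add_measure (density (restrict_space lborel \<Omega>) (\<lambda>x. ennreal (w x)))
       (scale_measure (ennreal (1 - (\<integral>x. w x \<partial>restrict_space lborel \<Omega>))) (dirac_on \<Omega> x0))"

lemma sets_recovery_measure:
  "sets (recovery_measure \<Omega> x0 w) = sets (restrict_space borel \<Omega>)"
  by (simp add: recovery_measure_def sets_restrict_space)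

lemma nn_integral_recovery_measure:
  assumes "x0 \<in> \<Omega>" "w \<in> borel_measurable (restrict_space lborel \<Omega>)"
    and f: "f \<in> borel_measurable (restrict_space borel \<Omega>)"
  shows "(\<integral>\<^sup>+x. f x \<partial>recovery_measure \<Omega> x0 w) = (\<integral>\<^sup>+x. ennreal (w x) * f x \<partial>restrict_space lborel \<Omega>)
      + ennreal (1 - (\<integral>x. w x \<partial>restrict_space lborel \<Omega>)) * f x0"
proof -
  have s: "sets (restrict_space lborel \<Omega>) = sets (restrict_space borel \<Omega>)"
    by (simp add: sets_restrict_space)
  have f': "f \<in> borel_measurable (restrict_space lborel \<Omega>)"
    using f measurable_cong_sets[OF s refl] by blast
  have fd: "f \<in> borel_measurable (dirac_on \<Omega> x0)"
    using f by (simp add: dirac_on_def)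
  have "(\<integral>\<^sup>+x. f x \<partial>dirac_on \<Omega> x0) = f x0"
    unfolding dirac_on_def using assms by (intro nn_integral_return) (auto simp: space_restrict_space)
  then show ?thesis
    unfolding recovery_measure_def using assms(2) f' fd
    by (subst nn_integral_add_measure)
      (auto simp: dirac_on_def s nn_integral_density nn_integral_scale_measure)
qed

lemma recovery_measure_in:
  assumes "x0 \<in> \<Omega>" and int: "integrable (restrict_space lborel \<Omega>) w" and "\<And>x. 0 \<le> w x"
    and "(\<integral>x. w x \<partial>restrict_space lborel \<Omega>) \<le> 1"
  shows "recovery_measure \<Omega> x0 w \<in> prob_measures_on \<Omega>"
proof -
  let ?m = "recovery_measure \<Omega> x0 w"
  have "emeasure ?m (space ?m) = (\<integral>\<^sup>+x. 1 \<partial>?m)" by simp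
  also have "\<dots> = (\<integral>\<^sup>+x. ennreal (w x) \<partial>restrict_space lborel \<Omega>)
      + ennreal (1 - (\<integral>x. w x \<partial>restrict_space lborel \<Omega>))"
    using int by (subst nn_integral_recovery_measure[OF assms(1)]) auto
  also have "\<dots> = 1"
    using assms by (simp add: nn_integral_eq_integral flip: ennreal_plus)
  finally show ?thesis
    unfolding prob_measures_on_def by (simp add: prob_spaceI sets_recovery_measure)
qed

text \<open>The atom is singular because it is concentrated on the Lebesgue null set
  \<open>{x0}\<close>.\<close>

lemma is_ac_density_recovery_measure:
  fixes \<Omega> :: "'a::euclidean_space set"
  assumes "closed \<Omega>" "x0 \<in> \<Omega>" and [measurable]: "w \<in> borel_measurable (restrict_space lborel \<Omega>)" and "\<And>x. 0 \<le> w x"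
  shows "is_ac_density (restrict_space lborel \<Omega>) (recovery_measure \<Omega> x0 w) w"
proof -
  let ?S = "scale_measure (ennreal (1 - (\<integral>x. w x \<partial>restrict_space lborel \<Omega>))) (dirac_on \<Omega> x0)"
  have S: "sets ?S = sets (restrict_space lborel \<Omega>)"
    by (simp add: dirac_on_def sets_restrict_space)
  have "{x0} \<in> null_sets (restrict_space lborel \<Omega>)"
    using assms by (subst null_sets_restrict_space) auto
  moreover have "emeasure ?S (space (restrict_space lborel \<Omega>) - {x0}) = 0"
  proof -
    have "\<Omega> - {x0} = \<Omega> \<inter> (- {x0})" by blast
    also have "\<dots> \<in> sets (restrict_space borel \<Omega>)" unfolding sets_restrict_space by (rule imageI) simp
    finally show ?thesis by (simp add: dirac_on_def space_restrict_space)
  qed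
  ultimately show ?thesis
    unfolding is_ac_density_def recovery_measure_def using assms S
    by (intro conjI exI[of _ ?S] bexI[of _ "{x0}"]) (auto simp: emeasure_add_measure)
qed

text \<open>Subtracting the constant \<open>f x0\<close> removes the contribution of the atom, so
  only the small mass of \<open>w\<close> is left. This will give weak* convergence to the Dirac
  mass.\<close>

lemma integral_recovery_measure_le:
  fixes \<Omega> :: "'a::euclidean_space set"
  assumes "compact \<Omega>" "x0 \<in> \<Omega>" and int: "integrable (restrict_space lborel \<Omega>) w" and w0: "\<And>x. 0 \<le> w x"
    and W: "(\<integral>x. w x \<partial>restrict_space lborel \<Omega>) \<le> 1"
    and f: "continuous_on \<Omega> f" and B: "\<And>x. x \<in> \<Omega> \<Longrightarrow> \<bar>f x\<bar> \<le> B"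
  shows "\<bar>(\<integral>x. f x \<partial>recovery_measure \<Omega> x0 w) - f x0\<bar> \<le> 2 * B * (\<integral>x. w x \<partial>restrict_space lborel \<Omega>)"
proof -
  let ?L = "restrict_space lborel \<Omega>" and ?m = "recovery_measure \<Omega> x0 w"
  have m: "?m \<in> prob_measures_on \<Omega>" by (rule recovery_measure_in) fact+
  interpret prob_space ?m by (rule prob_measures_onD(1)[OF m])
  have "B \<ge> 0" using B[OF assms(2)] by linarith
  have "integrable ?m f" "integrable ?m (\<lambda>x. f x - f x0)"
    using assms(1) m f by (auto intro!: integrable_continuous_on_compact continuous_intros)
  then have "ennreal \<bar>(\<integral>x. f x \<partial>?m) - f x0\<bar> \<le> (\<integral>\<^sup>+x. ennreal \<bar>f x - f x0\<bar> \<partial>?m)"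
    using integral_norm_bound_ennreal[of ?m "\<lambda>x. f x - f x0"] by (simp add: prob_space)
  also have "\<dots> = (\<integral>\<^sup>+x. ennreal (w x) * ennreal \<bar>f x - f x0\<bar> \<partial>?L)"
    using int borel_measurable_continuous_on_restrict[OF f]
    by (subst nn_integral_recovery_measure[OF assms(2)]) auto
  also have "\<dots> \<le> (\<integral>\<^sup>+x. ennreal (2 * B * w x) \<partial>?L)"
  proof (rule nn_integral_mono)
    fix x assume "x \<in> space ?L"
    then have "\<bar>f x - f x0\<bar> \<le> 2 * B"
      using B[of x] B[OF assms(2)] by (simp add: space_restrict_space)
    then show "ennreal (w x) * ennreal \<bar>f x - f x0\<bar> \<le> ennreal (2 * B * w x)"
      using w0[of x] mult_left_mono[of "\<bar>f x - f x0\<bar>" "2 * B" "w x"]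
      by (simp add: ennreal_leI mult.commute flip: ennreal_mult)
  qed
  also have "\<dots> = ennreal (2 * B * (\<integral>x. w x \<partial>?L))"
    using int w0 \<open>B \<ge> 0\<close> by (subst nn_integral_eq_integral) auto
  finally show ?thesis
    using \<open>B \<ge> 0\<close> w0 by (subst (asm) ennreal_le_iff) (auto intro!: integral_nonneg_AE mult_nonneg_nonneg)
qed

text \<open>The atom does not interact with itself, and its interaction with the density is counted
  twice. The density with itself contributes a term quadratic in the mass \<open>W\<close>, which is
  of lower order.\<close>

lemma interaction_recovery_measure_le:
  fixes \<Omega> :: "'a::euclidean_space set"
  assumes x0: "x0 \<in> \<Omega>" and int: "integrable (restrict_space lborel \<Omega>) w" and w0: "\<And>x. 0 \<le> w x"
    and W: "(\<integral>x. w x \<partial>restrict_space lborel \<Omega>) = W" "W \<le> 1"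
    and D: "\<And>x y. x \<in> \<Omega> \<Longrightarrow> y \<in> \<Omega> \<Longrightarrow> norm (x - y) \<le> D" and "q > 0"
  shows "(\<integral>\<^sup>+z. ennreal (norm (fst z - snd z) powr q) \<partial>(recovery_measure \<Omega> x0 w \<Otimes>\<^sub>M recovery_measure \<Omega> x0 w))
      \<le> 2 * (\<integral>\<^sup>+x. ennreal (w x) * ennreal (norm (x - x0) powr q) \<partial>restrict_space lborel \<Omega>) + ennreal (D powr q * W\<^sup>2)"
proof -
  let ?L = "restrict_space lborel \<Omega>" and ?m = "recovery_measure \<Omega> x0 w"
  have m: "?m \<in> prob_measures_on \<Omega>" using recovery_measure_in[OF x0 int w0] W by simp
  have W0: "W \<ge> 0" using w0 W by (auto intro: integral_nonneg_AE)
  have wW: "(\<integral>\<^sup>+x. ennreal (w x) \<partial>?L) = ennreal W"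
    using int w0 W by (simp add: nn_integral_eq_integral)
  have [measurable]: "w \<in> borel_measurable ?L" using int by auto
  define d where "d x y = ennreal (norm (x - y) powr q)" for x y :: 'a
  have db[measurable]: "d x \<in> borel_measurable borel" for x unfolding d_def by measurable
  have dL[measurable]: "d x \<in> borel_measurable ?L" "d x \<in> borel_measurable (restrict_space borel \<Omega>)" for x
    by (rule measurable_restrict_space1; simp)+
  have dsym: "d x y = d y x" for x y by (simp add: d_def norm_minus_commute)
  \<comment> \<open>\<open>P\<close> is the interaction of the density with a unit mass at
    \<open>x0\<close>; \<open>E\<close> bounds its interaction with a unit mass at any point of
    \<open>\<Omega>\<close>.\<close>
  define P where "P = (\<integral>\<^sup>+x. ennreal (w x) * d x0 x \<partial>?L)"
  define E where "E = ennreal (D powr q * W)"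
  have N: "(\<integral>\<^sup>+y. ennreal (w y) * d x y \<partial>?L) \<le> E" if x: "x \<in> \<Omega>" for x
  proof -
    have "(\<integral>\<^sup>+y. ennreal (w y) * d x y \<partial>?L) \<le> (\<integral>\<^sup>+y. ennreal (w y) * ennreal (D powr q) \<partial>?L)"
      unfolding d_def using x D \<open>q > 0\<close>
      by (intro nn_integral_mono mult_left_mono ennreal_leI powr_mono2) (auto simp: space_restrict_space)
    also have "\<dots> = E"
      using W0 by (simp add: nn_integral_multc wW E_def ennreal_mult mult.commute)
    finally show ?thesis .
  qed
  \<comment> \<open>At the atom \<open>x0\<close> the uniform bound \<open>E\<close> would be too crude: it is not multiplied by the small mass \<open>W\<close>.\<close>
  define F where "F x = (if x = x0 then P else E + d x0 x)" for x
  have Fb[measurable]: "F \<in> borel_measurable borel" unfolding F_def by measurable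
  have FL[measurable]: "F \<in> borel_measurable ?L" "F \<in> borel_measurable (restrict_space borel \<Omega>)"
    by (rule measurable_restrict_space1; simp)+
  have inner: "(\<integral>\<^sup>+y. d x y \<partial>?m) \<le> F x" if x: "x \<in> \<Omega>" for x
  proof -
    have "(\<integral>\<^sup>+y. d x y \<partial>?m) = (\<integral>\<^sup>+y. ennreal (w y) * d x y \<partial>?L) + ennreal (1 - W) * d x x0"
      by (subst nn_integral_recovery_measure[OF x0]) (auto simp: W)
    moreover have "d x0 x0 = 0" by (simp add: d_def)
    moreover have "ennreal (1 - W) * d x x0 \<le> 1 * d x x0"
      using W0 by (intro mult_right_mono) auto
    ultimately show ?thesis
      using N[OF x] by (auto simp: F_def P_def dsym[of x x0] intro: add_mono)
  qed
  have "(\<integral>\<^sup>+x. (\<integral>\<^sup>+y. d x y \<partial>?m) \<partial>?m) \<le> (\<integral>\<^sup>+x. F x \<partial>?m)"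
    using prob_measures_onD(4)[OF m] by (intro nn_integral_mono inner) simp
  also have "\<dots> = (\<integral>\<^sup>+x. ennreal (w x) * F x \<partial>?L) + ennreal (1 - W) * P"
    by (subst nn_integral_recovery_measure[OF x0]) (auto simp: W F_def)
  also have "\<dots> \<le> (\<integral>\<^sup>+x. ennreal (w x) * E + ennreal (w x) * d x0 x \<partial>?L) + 1 * P"
  proof (intro add_mono mult_right_mono nn_integral_mono)
    fix x
    \<comment> \<open>At \<open>x = x0\<close> this uses \<open>P \<le> E\<close>; the cruder bound
      is harmless here because it is integrated against \<open>w\<close>.\<close>
    have "F x \<le> E + d x0 x" using N[OF x0] by (auto simp: F_def P_def intro: order_trans)
    then show "ennreal (w x) * F x \<le> ennreal (w x) * E + ennreal (w x) * d x0 x"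
      by (simp add: mult_left_mono flip: distrib_left)
  qed (use W0 in auto)
  also have "\<dots> = ennreal W * E + 2 * P"
    by (simp add: nn_integral_add nn_integral_multc wW P_def mult_2 add.assoc)
  also have "ennreal W * E = ennreal (D powr q * W\<^sup>2)"
    unfolding E_def using W0 by (simp add: power2_eq_square ac_simps flip: ennreal_mult)
  finally show ?thesis
    unfolding nn_integral_interaction[OF m] P_def
    unfolding d_def[symmetric]
    by (simp add: dsym[of _ x0] add.commute)
qed

text \<open>The density \<open>\<epsilon> powr \<beta> * v\<close> cancels the prefactor of the cost
  by homogeneity and that of the linear interaction term directly. The quadratic term keeps one
  factor \<open>\<epsilon> powr \<beta>\<close> and vanishes in the limit.\<close>

lemma G_functional_recovery_measure:
  fixes \<Omega> :: "'a::euclidean_space set"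
  assumes cl: "closed \<Omega>" and x0: "x0 \<in> \<Omega>"
    and [measurable]: "\<rho> \<in> borel_measurable (restrict_space lborel \<Omega>)" and \<rho>0: "\<And>x. x \<in> \<Omega> \<Longrightarrow> 0 \<le> \<rho> x"
    and "p > 0" "q > 0" "\<epsilon> > 0"
    and int: "integrable (restrict_space lborel \<Omega>) v" and v0: "\<And>x. 0 \<le> v x"
    and V: "(\<integral>x. v x \<partial>restrict_space lborel \<Omega>) = V" "\<epsilon> powr \<beta> * V \<le> 1"
    and D: "\<And>x y. x \<in> \<Omega> \<Longrightarrow> y \<in> \<Omega> \<Longrightarrow> norm (x - y) \<le> D"
    and t: "t = p / real DIM('a)" and \<beta>: "\<beta> = 1 / (1 + t)"
  shows "G_functional \<Omega> \<rho> p q \<epsilon> (recovery_measure \<Omega> x0 (\<lambda>x. \<epsilon> powr \<beta> * v x))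
      \<le> (\<integral>\<^sup>+x. cost_integrand t (\<rho> x) (v x) + ennreal (2 * norm (x - x0) powr q * v x) \<partial>restrict_space lborel \<Omega>)
        + ennreal (\<epsilon> powr \<beta> * (D powr q * V\<^sup>2))"
proof -
  let ?L = "restrict_space lborel \<Omega>" and ?w = "\<lambda>x. \<epsilon> powr \<beta> * v x"
  let ?m = "recovery_measure \<Omega> x0 ?w"
  have tpos: "t > 0" using \<open>p > 0\<close> by (simp add: t)
  have [measurable]: "v \<in> borel_measurable ?L" using int by auto
  have V0: "V \<ge> 0" using v0 V by (auto intro: integral_nonneg_AE)
  have wint: "integrable ?L ?w" using int by simp
  have wV: "(\<integral>x. ?w x \<partial>?L) = \<epsilon> powr \<beta> * V" using V by simp
  have w0: "?w x \<ge> 0" for x using v0 by simp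
  have m: "?m \<in> prob_measures_on \<Omega>" using recovery_measure_in[OF x0 wint w0] V wV by simp
  have "is_ac_density ?L ?m (ac_density ?L ?m)" using cl m by (rule ac_density_prob_measure)
  moreover have "is_ac_density ?L ?m ?w"
    using wint w0 by (intro is_ac_density_recovery_measure cl x0) auto
  moreover have "sigma_finite_measure ?L"
    using cl by (intro sigma_finite_measure_restrict_space lborel.sigma_finite_measure_axioms) auto
  ultimately have ae: "AE x in ?L. ac_density ?L ?m x = ?w x"
    \<comment> \<open>Almost everywhere uniqueness identifies the density selected by
      \<open>SOME\<close> with the explicit one.\<close>
    by (intro is_ac_density_unique)
  have "ennreal (\<epsilon> powr (t / (1 + t))) * (\<integral>\<^sup>+x. cost_integrand t (\<rho> x) (ac_density ?L ?m x) \<partial>?L)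
      = ennreal (\<epsilon> powr (t / (1 + t))) * (\<integral>\<^sup>+x. cost_integrand t (\<rho> x) (?w x) \<partial>?L)"
    using ae by (intro arg_cong[where f="\<lambda>x. _ * x"] nn_integral_cong_AE) auto
  also have "\<dots> = (\<integral>\<^sup>+x. ennreal (\<epsilon> powr (t / (1 + t))) * cost_integrand t (\<rho> x) (?w x) \<partial>?L)"
    by (simp add: nn_integral_cmult)
  also have "\<dots> = (\<integral>\<^sup>+x. cost_integrand t (\<rho> x) (v x) \<partial>?L)"
  proof (rule nn_integral_cong)
    fix x assume "x \<in> space ?L"
    then show "ennreal (\<epsilon> powr (t / (1 + t))) * cost_integrand t (\<rho> x) (?w x) = cost_integrand t (\<rho> x) (v x)"
      using cost_integrand_scale[of t "\<epsilon> powr \<beta>" "\<rho> x" "v x"] \<rho>0[of x] v0[of x] tpos \<open>\<epsilon> > 0\<close>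
      by (simp add: powr_powr \<beta> space_restrict_space)
  qed
  finally have first: "ennreal (\<epsilon> powr (t / (1 + t))) * (\<integral>\<^sup>+x. cost_integrand t (\<rho> x) (ac_density ?L ?m x) \<partial>?L)
      = (\<integral>\<^sup>+x. cost_integrand t (\<rho> x) (v x) \<partial>?L)" .
  have [measurable]: "(\<lambda>x. norm (x - x0)) \<in> borel_measurable ?L"
    by (rule measurable_restrict_space1) simp
  have inv: "\<epsilon> powr (- \<beta>) * \<epsilon> powr \<beta> = 1" using \<open>\<epsilon> > 0\<close> by (simp flip: powr_add)
  have "ennreal (\<epsilon> powr (- \<beta>)) * (\<integral>\<^sup>+z. ennreal (norm (fst z - snd z) powr q) \<partial>(?m \<Otimes>\<^sub>M ?m))
      \<le> ennreal (\<epsilon> powr (- \<beta>)) * (2 * (\<integral>\<^sup>+x. ennreal (?w x) * ennreal (norm (x - x0) powr q) \<partial>?L)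
          + ennreal (D powr q * (\<epsilon> powr \<beta> * V)\<^sup>2))"
    using V by (intro mult_left_mono interaction_recovery_measure_le[OF x0 wint w0 wV _ D \<open>q > 0\<close>]) auto
  also have "\<dots> = ennreal (\<epsilon> powr (- \<beta>)) * (2 * (\<integral>\<^sup>+x. ennreal (?w x) * ennreal (norm (x - x0) powr q) \<partial>?L))
      + ennreal (\<epsilon> powr (- \<beta>) * (D powr q * (\<epsilon> powr \<beta> * V)\<^sup>2))"
    by (simp add: distrib_left flip: ennreal_mult)
  also have "ennreal (\<epsilon> powr (- \<beta>)) * (2 * (\<integral>\<^sup>+x. ennreal (?w x) * ennreal (norm (x - x0) powr q) \<partial>?L))
      = (\<integral>\<^sup>+x. ennreal (\<epsilon> powr (- \<beta>)) * (2 * (ennreal (?w x) * ennreal (norm (x - x0) powr q))) \<partial>?L)"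
    by (simp add: nn_integral_cmult)
  also have "\<dots> = (\<integral>\<^sup>+x. ennreal (2 * norm (x - x0) powr q * v x) \<partial>?L)"
  proof (rule nn_integral_cong)
    fix x
    have "ennreal (\<epsilon> powr (- \<beta>)) * (2 * (ennreal (?w x) * ennreal (norm (x - x0) powr q)))
        = ennreal (\<epsilon> powr (- \<beta>) * (2 * (?w x * norm (x - x0) powr q)))"
      using w0 v0 by (simp add: ennreal_mult)
    also have "\<epsilon> powr (- \<beta>) * (2 * (?w x * norm (x - x0) powr q))
        = (\<epsilon> powr (- \<beta>) * \<epsilon> powr \<beta>) * (2 * norm (x - x0) powr q * v x)"
      by (simp only: ac_simps)
    finally show "ennreal (\<epsilon> powr (- \<beta>)) * (2 * (ennreal (?w x) * ennreal (norm (x - x0) powr q)))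
        = ennreal (2 * norm (x - x0) powr q * v x)" unfolding inv by simp
  qed
  also have "\<epsilon> powr (- \<beta>) * (D powr q * (\<epsilon> powr \<beta> * V)\<^sup>2)
      = (\<epsilon> powr (- \<beta>) * \<epsilon> powr \<beta>) * (\<epsilon> powr \<beta> * (D powr q * V\<^sup>2))"
    by (simp only: power2_eq_square ac_simps)
  finally have second: "ennreal (\<epsilon> powr (- \<beta>)) * (\<integral>\<^sup>+z. ennreal (norm (fst z - snd z) powr q) \<partial>(?m \<Otimes>\<^sub>M ?m))
      \<le> (\<integral>\<^sup>+x. ennreal (2 * norm (x - x0) powr q * v x) \<partial>?L) + ennreal (\<epsilon> powr \<beta> * (D powr q * V\<^sup>2))"
    unfolding inv by simp
  have "G_functional \<Omega> \<rho> p q \<epsilon> ?m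
     = ennreal (\<epsilon> powr (t / (1 + t))) * (\<integral>\<^sup>+x. cost_integrand t (\<rho> x) (ac_density ?L ?m x) \<partial>?L)
      + ennreal (\<epsilon> powr (- \<beta>)) * (\<integral>\<^sup>+z. ennreal (norm (fst z - snd z) powr q) \<partial>(?m \<Otimes>\<^sub>M ?m))"
    unfolding G_functional_def Let_def nn_integral_lebesgue_on_lborel[OF cl] t[symmetric] \<beta>[symmetric] ..
  also have "\<dots> \<le> (\<integral>\<^sup>+x. cost_integrand t (\<rho> x) (v x) \<partial>?L)
      + ((\<integral>\<^sup>+x. ennreal (2 * norm (x - x0) powr q * v x) \<partial>?L) + ennreal (\<epsilon> powr \<beta> * (D powr q * V\<^sup>2)))"
    unfolding first by (intro add_left_mono second)
  also have "\<dots> = (\<integral>\<^sup>+x. cost_integrand t (\<rho> x) (v x) + ennreal (2 * norm (x - x0) powr q * v x) \<partial>?L)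
        + ennreal (\<epsilon> powr \<beta> * (D powr q * V\<^sup>2))"
    by (subst nn_integral_add) (auto simp: add.assoc)
  finally show ?thesis .
qed

section \<open>Limsup inequality at Dirac masses\<close>

text \<open>On a set of finite measure this makes a power of \<open>\<rho>\<close> with exponent
  between 0 and 1 integrable along with \<open>\<rho>\<close>.\<close>

lemma powr_le_one_plus:
  fixes r a :: real
  assumes "0 \<le> r" "0 \<le> a" "a \<le> 1"
  shows "r powr a \<le> 1 + r"
proof (cases "r \<le> 1")
  case True
  then have "r powr a \<le> 1" using assms by (simp add: powr_le1)
  then show ?thesis using assms by linarith
next
  case False
  then have "r powr a \<le> r powr 1" using assms by (intro powr_mono) auto
  then show ?thesis using assms by simp
qed

lemma finite_measure_lborel_compact:
  fixes \<Omega> :: "'a::euclidean_space set"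
  assumes "compact \<Omega>"
  shows "finite_measure (restrict_space lborel \<Omega>)"
proof (rule finite_measureI)
  have "\<Omega> \<in> sets lborel" using assms by (simp add: borel_compact)
  then show "emeasure (restrict_space lborel \<Omega>) (space (restrict_space lborel \<Omega>)) \<noteq> \<infinity>"
    using emeasure_compact_finite[OF assms] by (simp add: space_restrict_space emeasure_restrict_space)
qed

text \<open>The pointwise optimal density \<open>(t \<rho> / (2 |x - x0|^q)) powr \<beta>\<close> need not be integrable at \<open>x0\<close>,
  so the distance is truncated from below at \<open>\<delta>\<close>.\<close>

lemma Limsup_dirac_truncated:
  fixes \<Omega> :: "'a::euclidean_space set"
  assumes \<Omega>: "compact \<Omega>" and x0: "x0 \<in> \<Omega>"
    and \<rho>: "integrable (restrict_space lborel \<Omega>) \<rho>" and \<rho>0: "\<And>x. x \<in> \<Omega> \<Longrightarrow> 0 \<le> \<rho> x"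
    and "p > 0" "q > 0" "\<delta> > 0"
    and t: "t = p / real DIM('a)"
  shows "\<exists>m. (\<forall>\<epsilon>>0. m \<epsilon> \<in> prob_measures_on \<Omega>) \<and> weak_star_tendsto \<Omega> m (dirac_on \<Omega> x0) \<and>
    Limsup (at_right 0) (\<lambda>\<epsilon>. G_functional \<Omega> \<rho> p q \<epsilon> (m \<epsilon>)) \<le>
      (\<integral>\<^sup>+x. ennreal ((1 + t) * (2 / t) powr (t / (1 + t)) *
        (\<rho> x powr (1 / (1 + t)) * max \<delta> (norm (x - x0)) powr (t / (1 + t) * q))) \<partial>restrict_space lborel \<Omega>)"
proof -
  let ?L = "restrict_space lborel \<Omega>"
  interpret L: finite_measure ?L by (rule finite_measure_lborel_compact[OF \<Omega>])
  have cl: "closed \<Omega>" using \<Omega> by (rule compact_imp_closed)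
  define \<alpha> \<beta> where "\<alpha> = t / (1 + t)" and "\<beta> = 1 / (1 + t)"
  have tpos: "t > 0" using \<open>p > 0\<close> by (simp add: t)
  have \<beta>: "\<beta> > 0" "\<beta> \<le> 1" using tpos by (auto simp: \<beta>_def)
  have [measurable]: "\<rho> \<in> borel_measurable ?L" using \<rho> by auto
  define s where "s x = max \<delta> (norm (x - x0))" for x
  have s: "s x \<ge> \<delta>" "s x > 0" "norm (x - x0) \<le> s x" for x using \<open>\<delta> > 0\<close> by (auto simp: s_def)
  have "s \<in> borel_measurable lborel" unfolding s_def by measurable
  then have [measurable]: "s \<in> borel_measurable ?L" by (rule measurable_restrict_space1)
  \<comment> \<open>The pointwise minimiser for the interaction coefficient
    \<open>2 * s x powr q\<close>, with \<open>s\<close> the truncated distance.\<close>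
  define v where "v x = (t * \<rho> x / (2 * s x powr q)) powr \<beta>" for x
  have v0: "v x \<ge> 0" for x by (simp add: v_def)
  have int: "integrable ?L v"
  proof (rule Bochner_Integration.integrable_bound)
    show "integrable ?L (\<lambda>x. (t / (2 * \<delta> powr q)) powr \<beta> * (1 + \<rho> x))"
      using \<rho> by (intro integrable_mult_right Bochner_Integration.integrable_add) auto
    show "v \<in> borel_measurable ?L" unfolding v_def by measurable
    show "AE x in ?L. norm (v x) \<le> norm ((t / (2 * \<delta> powr q)) powr \<beta> * (1 + \<rho> x))"
    proof (rule AE_I2)
      fix x assume "x \<in> space ?L"
      then have r: "\<rho> x \<ge> 0" using \<rho>0 by (simp add: space_restrict_space)
      have "t * \<rho> x / (2 * s x powr q) \<le> t * \<rho> x / (2 * \<delta> powr q)"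
        using tpos r s[of x] \<open>\<delta> > 0\<close> \<open>q > 0\<close>
        by (intro divide_left_mono mult_left_mono powr_mono2) auto
      then have "v x \<le> (t * \<rho> x / (2 * \<delta> powr q)) powr \<beta>"
        unfolding v_def using \<beta> tpos r by (intro powr_mono2) auto
      also have "\<dots> = (t / (2 * \<delta> powr q)) powr \<beta> * \<rho> x powr \<beta>"
        using tpos r by (simp add: powr_mult powr_divide)
      also have "\<dots> \<le> (t / (2 * \<delta> powr q)) powr \<beta> * (1 + \<rho> x)"
        using r \<beta> by (intro mult_left_mono powr_le_one_plus) auto
      finally show "norm (v x) \<le> norm ((t / (2 * \<delta> powr q)) powr \<beta> * (1 + \<rho> x))"
        using v0[of x] r by simp
    qed
  qed
  define V where "V = (\<integral>x. v x \<partial>?L)"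
  have V0: "V \<ge> 0" unfolding V_def using v0 by (auto intro: integral_nonneg_AE)
  obtain D where D: "\<And>x y. x \<in> \<Omega> \<Longrightarrow> y \<in> \<Omega> \<Longrightarrow> norm (x - y) \<le> D"
    using bounded_two_points[of \<Omega>] compact_imp_bounded[OF \<Omega>] by (auto simp: dist_norm)
  \<comment> \<open>For large \<open>\<epsilon>\<close> the density could have mass above 1; the
    Dirac mass then keeps the family admissible. The limit sees only the first branch.\<close>
  define m where "m \<epsilon> = (if \<epsilon> powr \<beta> * V \<le> 1 then recovery_measure \<Omega> x0 (\<lambda>x. \<epsilon> powr \<beta> * v x) else dirac_on \<Omega> x0)" for \<epsilon> :: real
  have small: "((\<lambda>\<epsilon>::real. \<epsilon> powr \<beta> * c) \<longlongrightarrow> 0) (at_right 0)" for c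
    using \<beta> by real_asymp
  have ev: "\<forall>\<^sub>F \<epsilon> in at_right 0. \<epsilon> powr \<beta> * V \<le> 1"
    using order_tendstoD(2)[OF small[of V], of 1] by (auto elim: eventually_mono)
  have mem: "m \<epsilon> \<in> prob_measures_on \<Omega>" for \<epsilon>
  proof (cases "\<epsilon> powr \<beta> * V \<le> 1")
    case True
    then have "recovery_measure \<Omega> x0 (\<lambda>x. \<epsilon> powr \<beta> * v x) \<in> prob_measures_on \<Omega>"
      using int v0 by (intro recovery_measure_in x0) (auto simp: V_def)
    then show ?thesis using True by (simp add: m_def)
  next
    case False
    have "prob_space (dirac_on \<Omega> x0)"
      unfolding dirac_on_def using x0 by (intro prob_space_return) (simp add: space_restrict_space)
    then show ?thesis using False by (simp add: m_def prob_measures_on_def dirac_on_def)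
  qed
  have conv: "weak_star_tendsto \<Omega> m (dirac_on \<Omega> x0)"
    unfolding weak_star_tendsto_def
  proof (intro allI impI)
    fix f :: "'a \<Rightarrow> real" assume f: "continuous_on \<Omega> f"
    have "bounded (f ` \<Omega>)"
      using \<Omega> f compact_continuous_image compact_imp_bounded by blast
    then obtain B where B: "\<And>x. x \<in> \<Omega> \<Longrightarrow> \<bar>f x\<bar> \<le> B"
      by (auto simp: bounded_iff)
    have "((\<lambda>\<epsilon>. (\<integral>x. f x \<partial>m \<epsilon>) - f x0) \<longlongrightarrow> 0) (at_right 0)"
    proof (rule Lim_null_comparison)
      show "((\<lambda>\<epsilon>. \<epsilon> powr \<beta> * (2 * B * V)) \<longlongrightarrow> 0) (at_right 0)" by (rule small)
      show "\<forall>\<^sub>F \<epsilon> in at_right 0. norm ((\<integral>x. f x \<partial>m \<epsilon>) - f x0) \<le> \<epsilon> powr \<beta> * (2 * B * V)"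
        using ev
      proof eventually_elim
        case (elim \<epsilon>)
        then show ?case
          using integral_recovery_measure_le[OF \<Omega> x0 _ _ _ f B, of "\<lambda>x. \<epsilon> powr \<beta> * v x"] int v0
          by (simp add: m_def V_def ac_simps)
      qed
    qed
    then show "((\<lambda>\<epsilon>. \<integral>x. f x \<partial>m \<epsilon>) \<longlongrightarrow> (\<integral>x. f x \<partial>dirac_on \<Omega> x0)) (at_right 0)"
      unfolding integral_dirac_on[OF x0 f] by (rule LIM_zero_cancel)
  qed
  define J where "J = (\<integral>\<^sup>+x. ennreal ((1 + t) * (2 / t) powr \<alpha> * (\<rho> x powr \<beta> * s x powr (\<alpha> * q))) \<partial>?L)"
  have J: "(\<integral>\<^sup>+x. cost_integrand t (\<rho> x) (v x) + ennreal (2 * norm (x - x0) powr q * v x) \<partial>?L) \<le> J"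
    unfolding J_def
  proof (rule nn_integral_mono)
    fix x assume "x \<in> space ?L"
    then have r: "\<rho> x \<ge> 0" using \<rho>0 by (simp add: space_restrict_space)
    \<comment> \<open>Enlarge the distance to \<open>s x\<close> first: \<open>v\<close> is optimal
      for the truncated coefficient, not for the true one.\<close>
    have "2 * norm (x - x0) powr q * v x \<le> 2 * s x powr q * v x"
      using s[of x] v0[of x] \<open>q > 0\<close> by (intro mult_right_mono mult_left_mono powr_mono2) auto
    then have "cost_integrand t (\<rho> x) (v x) + ennreal (2 * norm (x - x0) powr q * v x)
        \<le> cost_integrand t (\<rho> x) (v x) + ennreal (2 * s x powr q * v x)"
      by (intro add_left_mono ennreal_leI)
    also have "\<dots> = ennreal ((1 + t) * (2 * s x powr q / t) powr (t / (1 + t)) * \<rho> x powr (1 / (1 + t)))"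
      using s[of x] by (intro cost_integrand_minimum tpos r) (auto simp: v_def \<beta>_def)
    also have "(2 * s x powr q / t) powr (t / (1 + t)) = (2 / t) powr \<alpha> * s x powr (\<alpha> * q)"
      using tpos by (simp add: powr_mult powr_divide powr_powr \<alpha>_def mult.commute)
    finally show "cost_integrand t (\<rho> x) (v x) + ennreal (2 * norm (x - x0) powr q * v x)
        \<le> ennreal ((1 + t) * (2 / t) powr \<alpha> * (\<rho> x powr \<beta> * s x powr (\<alpha> * q)))"
      by (simp add: \<beta>_def ac_simps)
  qed
  have "Limsup (at_right 0) (\<lambda>\<epsilon>. G_functional \<Omega> \<rho> p q \<epsilon> (m \<epsilon>))
      \<le> Limsup (at_right 0) (\<lambda>\<epsilon>. J + ennreal (\<epsilon> powr \<beta> * (D powr q * V\<^sup>2)))"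
  proof (rule Limsup_mono)
    show "\<forall>\<^sub>F \<epsilon> in at_right 0. G_functional \<Omega> \<rho> p q \<epsilon> (m \<epsilon>) \<le> J + ennreal (\<epsilon> powr \<beta> * (D powr q * V\<^sup>2))"
      using ev eventually_at_right_less[of 0]
    proof eventually_elim
      case (elim \<epsilon>)
      have "G_functional \<Omega> \<rho> p q \<epsilon> (m \<epsilon>)
        \<le> (\<integral>\<^sup>+x. cost_integrand t (\<rho> x) (v x) + ennreal (2 * norm (x - x0) powr q * v x) \<partial>?L)
            + ennreal (\<epsilon> powr \<beta> * (D powr q * V\<^sup>2))"
        using elim
          G_functional_recovery_measure[OF cl x0 _ \<rho>0 \<open>p > 0\<close> \<open>q > 0\<close> _ int v0 V_def[symmetric] _ D t \<beta>_def, where \<epsilon> = \<epsilon>]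
        by (simp add: m_def)
      also have "\<dots> \<le> J + ennreal (\<epsilon> powr \<beta> * (D powr q * V\<^sup>2))"
        by (intro add_right_mono J)
      finally show ?case .
    qed
  qed
  also have "\<dots> = J"
  proof (rule lim_imp_Limsup)
    have "((\<lambda>\<epsilon>. J + ennreal (\<epsilon> powr \<beta> * (D powr q * V\<^sup>2))) \<longlongrightarrow> J + ennreal 0) (at_right 0)"
      by (intro tendsto_add tendsto_const tendsto_ennrealI small)
    then show "((\<lambda>\<epsilon>. J + ennreal (\<epsilon> powr \<beta> * (D powr q * V\<^sup>2))) \<longlongrightarrow> J) (at_right 0)" by simp
  qed simp
  finally show ?thesis
    using mem conv unfolding J_def s_def \<alpha>_def \<beta>_def by blast
qed

text \<open>Each truncation level bounds the infimum from above, so it suffices to let the level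
  \<open>1 / (real n + 1)\<close> tend to 0 under the integral, by dominated convergence. No
  diagonal family is constructed.\<close>

lemma Inf_Limsup_dirac:
  fixes \<Omega> :: "'a::euclidean_space set"
  assumes \<Omega>: "compact \<Omega>" and x0: "x0 \<in> \<Omega>"
    and \<rho>: "integrable (restrict_space lborel \<Omega>) \<rho>" and \<rho>0: "\<And>x. x \<in> \<Omega> \<Longrightarrow> 0 \<le> \<rho> x"
    and "p > 0" "q > 0"
  shows "Inf {Limsup (at_right 0) (\<lambda>\<epsilon>. G_functional \<Omega> \<rho> p q \<epsilon> (m \<epsilon>)) | m.
      (\<forall>\<epsilon>>0. m \<epsilon> \<in> prob_measures_on \<Omega>) \<and> weak_star_tendsto \<Omega> m (dirac_on \<Omega> x0)}
    \<le> H_dirac \<Omega> \<rho> p q x0" (is "?I \<le> _")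
proof -
  let ?L = "restrict_space lborel \<Omega>"
  interpret L: finite_measure ?L by (rule finite_measure_lborel_compact[OF \<Omega>])
  have cl: "closed \<Omega>" using \<Omega> by (rule compact_imp_closed)
  define t where "t = p / real DIM('a)"
  define \<alpha> \<beta> K where "\<alpha> = t / (1 + t)" and "\<beta> = 1 / (1 + t)" and "K = (1 + t) * (2 / t) powr \<alpha>"
  have t: "t > 0" using \<open>p > 0\<close> by (simp add: t_def)
  have ab: "\<alpha> > 0" "\<beta> > 0" "\<beta> \<le> 1" "K \<ge> 0" using t by (auto simp: \<alpha>_def \<beta>_def K_def)
  have [measurable]: "\<rho> \<in> borel_measurable ?L" using \<rho> by auto
  have [measurable]: "(\<lambda>x. norm (x - x0)) \<in> borel_measurable ?L"
    by (rule measurable_restrict_space1) simp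
  obtain D where D: "\<And>x. x \<in> \<Omega> \<Longrightarrow> norm (x - x0) \<le> D"
    using bounded_two_points[of \<Omega>] compact_imp_bounded[OF \<Omega>] x0 by (auto simp: dist_norm)
  have D0: "D \<ge> 0" using D[OF x0] by simp
  define h where "h n x = ennreal (K * (\<rho> x powr \<beta> * max (1 / (real n + 1)) (norm (x - x0)) powr (\<alpha> * q)))" for n x
  define h' where "h' x = ennreal (K * (\<rho> x powr \<beta> * norm (x - x0) powr (\<alpha> * q)))" for x
  have I: "?I \<le> (\<integral>\<^sup>+x. h n x \<partial>?L)" for n
  proof -
    obtain m where "\<forall>\<epsilon>>0. m \<epsilon> \<in> prob_measures_on \<Omega>" "weak_star_tendsto \<Omega> m (dirac_on \<Omega> x0)"
      "Limsup (at_right 0) (\<lambda>\<epsilon>. G_functional \<Omega> \<rho> p q \<epsilon> (m \<epsilon>)) \<le> (\<integral>\<^sup>+x. h n x \<partial>?L)"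
      using Limsup_dirac_truncated[OF \<Omega> x0 \<rho> \<rho>0 \<open>p > 0\<close> \<open>q > 0\<close> _ t_def, of "1 / (real n + 1)"]
      unfolding h_def K_def \<alpha>_def \<beta>_def by auto
    then show ?thesis by (blast intro: Inf_lower2)
  qed
  have "(\<lambda>n. \<integral>\<^sup>+x. h n x \<partial>?L) \<longlonglongrightarrow> (\<integral>\<^sup>+x. h' x \<partial>?L)"
  proof (rule nn_integral_dominated_convergence)
    show "h n \<in> borel_measurable ?L" for n unfolding h_def by measurable
    show "h' \<in> borel_measurable ?L" unfolding h'_def by measurable
    \<comment> \<open>The dominating function uses that the truncated distance is at most
      \<open>1 + D\<close>, the level being at most 1, and that
      \<open>\<rho> x powr \<beta> \<le> 1 + \<rho> x\<close>.\<close>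
    show "(\<lambda>x. ennreal (K * ((1 + D) powr (\<alpha> * q) * (1 + \<rho> x)))) \<in> borel_measurable ?L" by measurable
    have "integrable ?L (\<lambda>x. K * ((1 + D) powr (\<alpha> * q) * (1 + \<rho> x)))"
      using \<rho> by (intro integrable_mult_right Bochner_Integration.integrable_add) auto
    then show "(\<integral>\<^sup>+x. ennreal (K * ((1 + D) powr (\<alpha> * q) * (1 + \<rho> x))) \<partial>?L) < \<infinity>"
      using ab \<rho>0 by (subst nn_integral_eq_integral) (auto simp: space_restrict_space)
    show "AE x in ?L. h n x \<le> ennreal (K * ((1 + D) powr (\<alpha> * q) * (1 + \<rho> x)))" for n
    proof (rule AE_I2)
      fix x assume "x \<in> space ?L"
      then have x: "x \<in> \<Omega>" by (simp add: space_restrict_space)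
      have "max (1 / (real n + 1)) (norm (x - x0)) powr (\<alpha> * q) \<le> (1 + D) powr (\<alpha> * q)"
        using ab \<open>q > 0\<close> D[OF x] D0 by (intro powr_mono2) (auto simp: max_def field_simps)
      moreover have "\<rho> x powr \<beta> \<le> 1 + \<rho> x" using ab \<rho>0[OF x] by (intro powr_le_one_plus) auto
      ultimately have "max (1 / (real n + 1)) (norm (x - x0)) powr (\<alpha> * q) * \<rho> x powr \<beta> \<le> (1 + D) powr (\<alpha> * q) * (1 + \<rho> x)"
        by (intro mult_mono) auto
      then show "h n x \<le> ennreal (K * ((1 + D) powr (\<alpha> * q) * (1 + \<rho> x)))"
        unfolding h_def using ab by (intro ennreal_leI mult_left_mono) (auto simp: mult.commute)
    qed
    show "AE x in ?L. (\<lambda>n. h n x) \<longlonglongrightarrow> h' x"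
    proof (rule AE_I2)
      fix x
      have "(\<lambda>n. 1 / (real n + 1)) \<longlonglongrightarrow> 0" by real_asymp
      then have "(\<lambda>n. K * (\<rho> x powr \<beta> * max (1 / (real n + 1)) (norm (x - x0)) powr (\<alpha> * q)))
        \<longlonglongrightarrow> K * (\<rho> x powr \<beta> * max 0 (norm (x - x0)) powr (\<alpha> * q))"
        using ab \<open>q > 0\<close> by (intro tendsto_intros tendsto_powr2) (auto simp: le_max_iff_disj)
      then show "(\<lambda>n. h n x) \<longlonglongrightarrow> h' x" unfolding h_def h'_def by (intro tendsto_ennrealI) simp
    qed
  qed
  then have "?I \<le> (\<integral>\<^sup>+x. h' x \<partial>?L)"
    by (rule LIMSEQ_le_const) (use I in blast)
  also have "\<dots> = (\<integral>\<^sup>+x. ennreal K * ennreal (\<rho> x powr \<beta> * norm (x - x0) powr (\<alpha> * q)) \<partial>?L)"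
    using ab by (simp add: h'_def ennreal_mult)
  also have "\<dots> = ennreal K * (\<integral>\<^sup>+x. ennreal (\<rho> x powr \<beta> * norm (x - x0) powr (\<alpha> * q)) \<partial>?L)"
    by (rule nn_integral_cmult) measurable
  also have "\<dots> = H_dirac \<Omega> \<rho> p q x0"
    by (simp add: H_dirac_def Let_def nn_integral_lebesgue_on_lborel[OF cl] K_def \<alpha>_def \<beta>_def t_def)
  finally show ?thesis .
qed

section \<open>Reduction to a Borel weight and conclusion\<close>

lemma G_functional_cong_AE:
  fixes \<Omega> :: "'a::euclidean_space set"
  assumes "closed \<Omega>" "AE x in restrict_space lborel \<Omega>. \<rho> x = r x"
  shows "G_functional \<Omega> \<rho> p q = G_functional \<Omega> r p q"
proof -
  have "(\<integral>\<^sup>+x. cost_integrand t (\<rho> x) (u x) \<partial>restrict_space lborel \<Omega>)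
      = (\<integral>\<^sup>+x. cost_integrand t (r x) (u x) \<partial>restrict_space lborel \<Omega>)" for t u
    using assms(2) by (intro nn_integral_cong_AE) auto
  then show ?thesis
    by (simp add: G_functional_def Let_def nn_integral_lebesgue_on_lborel[OF assms(1)] fun_eq_iff)
qed

lemma H_functional_cong_AE:
  fixes \<Omega> :: "'a::euclidean_space set"
  assumes "closed \<Omega>" "AE x in restrict_space lborel \<Omega>. \<rho> x = r x"
  shows "H_functional \<Omega> \<rho> p q = H_functional \<Omega> r p q"
proof -
  have "(\<integral>\<^sup>+x. ennreal (\<rho> x powr b * norm (x - x0) powr a) \<partial>restrict_space lborel \<Omega>)
      = (\<integral>\<^sup>+x. ennreal (r x powr b * norm (x - x0) powr a) \<partial>restrict_space lborel \<Omega>)" for a b x0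
    using assms(2) by (intro nn_integral_cong_AE) auto
  then show ?thesis
    by (simp add: H_functional_def H_dirac_def Let_def nn_integral_lebesgue_on_lborel[OF assms(1)] fun_eq_iff)
qed

text \<open>An integrable \<open>\<rho>\<close> is only Lebesgue measurable, whereas the estimates
  work with Borel functions. A Lebesgue measurable function agrees almost everywhere with a Borel
  one.\<close>

lemma integrable_lebesgue_on_borel_version:
  fixes \<rho> :: "'a::euclidean_space \<Rightarrow> real"
  assumes "closed \<Omega>" and int: "integrable (lebesgue_on \<Omega>) \<rho>" and \<rho>0: "\<And>x. x \<in> \<Omega> \<Longrightarrow> 0 \<le> \<rho> x"
  obtains r where "integrable (restrict_space lborel \<Omega>) r" "\<And>x. 0 \<le> r x"
    "AE x in restrict_space lborel \<Omega>. \<rho> x = r x"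
proof -
  let ?L = "restrict_space lborel \<Omega>"
  have [measurable]: "\<Omega> \<in> sets borel" using assms(1) by simp
  have "(\<lambda>x. indicator \<Omega> x *\<^sub>R \<rho> x) \<in> borel_measurable lebesgue"
    using int borel_measurable_integrable[OF int] by (subst (asm) borel_measurable_restrict_space_iff) auto
  then obtain g where g: "g \<in> borel_measurable lborel" "AE x in lborel. indicator \<Omega> x *\<^sub>R \<rho> x = g x"
    using completion_ex_borel_measurable_real by blast
  \<comment> \<open>The Borel version inherits the sign of \<open>\<rho>\<close> only almost
    everywhere; its positive part is nonnegative everywhere and still agrees with
    \<open>\<rho>\<close> almost everywhere on \<open>\<Omega>\<close>.\<close>
  define r where "r x = max 0 (g x)" for x
  have "AE x in lborel. x \<in> \<Omega> \<longrightarrow> \<rho> x = r x"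
    using g(2) by eventually_elim (use \<rho>0 in \<open>force simp: r_def\<close>)
  then have ae: "AE x in ?L. \<rho> x = r x"
    by (subst AE_restrict_space_iff) auto
  have "r \<in> borel_measurable lborel" unfolding r_def using g(1) by measurable
  then have m: "r \<in> borel_measurable ?L" by (rule measurable_restrict_space1)
  have "(\<integral>\<^sup>+x. ennreal (norm (r x)) \<partial>?L) = (\<integral>\<^sup>+x. ennreal (norm (\<rho> x)) \<partial>?L)"
    using ae by (intro nn_integral_cong_AE) auto
  also have "\<dots> < \<infinity>"
    using int by (simp add: integrable_iff_bounded nn_integral_lebesgue_on_lborel[OF assms(1)])
  finally have "integrable ?L r" using m by (simp add: integrable_iff_bounded)
  with ae that[of r] show ?thesis by (simp add: r_def)
qed

theorem mainTheorem1:
  fixes \<Omega> :: "'a::euclidean_space set" and \<rho> :: "'a \<Rightarrow> real" and p q :: real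
  assumes "bounded \<Omega>" and "closed \<Omega>"
    and "\<And>x. x \<in> \<Omega> \<Longrightarrow> 0 \<le> \<rho> x"
    and "integrable (lebesgue_on \<Omega>) \<rho>"
    and "p > 0" and "q > 0"
  shows "gamma_converges (prob_measures_on \<Omega>) (weak_star_tendsto \<Omega>)
           (G_functional \<Omega> \<rho> p q) (H_functional \<Omega> \<rho> p q)"
proof -
  have \<Omega>: "compact \<Omega>" using assms by (simp add: compact_eq_bounded_closed)
  obtain r where r: "integrable (restrict_space lborel \<Omega>) r" "\<And>x. 0 \<le> r x"
    and ae: "AE x in restrict_space lborel \<Omega>. \<rho> x = r x"
    using integrable_lebesgue_on_borel_version[OF assms(2,4,3)] by blast
  have rm: "r \<in> borel_measurable (restrict_space lborel \<Omega>)" using r(1) by auto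
  \<comment> \<open>Both functionals depend on the weight only up to null sets, so
    \<open>\<rho>\<close> may be replaced by its Borel version \<open>r\<close> throughout.\<close>
  show ?thesis
    unfolding G_functional_cong_AE[OF assms(2) ae] H_functional_cong_AE[OF assms(2) ae] gamma_converges_def
  proof (intro ballI conjI allI impI)
    fix \<mu> m
    assume \<mu>: "\<mu> \<in> prob_measures_on \<Omega>"
      and m: "(\<forall>\<epsilon>>0. m \<epsilon> \<in> prob_measures_on \<Omega>) \<and> weak_star_tendsto \<Omega> m \<mu>"
    show "H_functional \<Omega> r p q \<mu> \<le> Liminf (at_right 0) (\<lambda>\<epsilon>. G_functional \<Omega> r p q \<epsilon> (m \<epsilon>))"
    proof (cases "\<exists>x0\<in>\<Omega>. \<mu> = dirac_on \<Omega> x0")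
      case True
      then obtain x0 where x0: "x0 \<in> \<Omega>" "\<mu> = dirac_on \<Omega> x0" by blast
      show ?thesis
        unfolding x0(2) H_functional_dirac[OF x0(1)]
        using m x0 by (intro Liminf_dirac \<Omega> x0(1) rm r(2) assms(5,6)) auto
    next
      case False
      then have "Liminf (at_right 0) (\<lambda>\<epsilon>. G_functional \<Omega> r p q \<epsilon> (m \<epsilon>)) = \<infinity>"
        using m by (intro Liminf_non_dirac[OF \<Omega> \<mu>] assms(5,6)) auto
      then show ?thesis by simp
    qed
  next
    fix \<mu> assume \<mu>: "\<mu> \<in> prob_measures_on \<Omega>"
    show "Inf {Limsup (at_right 0) (\<lambda>\<epsilon>. G_functional \<Omega> r p q \<epsilon> (m \<epsilon>)) | m.
        (\<forall>\<epsilon>>0. m \<epsilon> \<in> prob_measures_on \<Omega>) \<and> weak_star_tendsto \<Omega> m \<mu>} \<le> H_functional \<Omega> r p q \<mu>"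
    proof (cases "\<exists>x0\<in>\<Omega>. \<mu> = dirac_on \<Omega> x0")
      case True
      then obtain x0 where x0: "x0 \<in> \<Omega>" "\<mu> = dirac_on \<Omega> x0" by blast
      show ?thesis
        unfolding x0(2) H_functional_dirac[OF x0(1)]
        by (rule Inf_Limsup_dirac[OF \<Omega> x0(1) r(1,2) assms(5,6)])
    next
      case False
      then show ?thesis by (simp add: H_functional_def)
    qed
  qed
qed

end
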